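(* Let $G$ be a non-unimodular locally compact second countable group and let $\Gamma$ be a countable dense subgroup of $G$ such that the left translation action $\Gamma\curvearrowright G$ is strongly ergodic. Then there exist infinitely many pairwise non-topologically-isomorphic locally compact second countable groups $G_i$ ($i\in\mathbb{N}$), each having a countable dense subgroup $\Gamma_i< G_i$ whose left translation action $\Gamma_i\curvearrowright G_i$ is orbit equivalent to $\Gamma\curvearrowright G$.
   Context: Every locally compact second countable group $K$ is equipped with a probability measure $\mu_K$ equivalent to its left Haar measure. A non-singular countable Borel equivalence relation $\mathcal{R}$ on a standard probability space $(X,\mu)$ has full group $[\mathcal{R}]$, the group of (non-singular) Borel automorphisms $g$ of $X$ with $(gx,x)\in\mathcal{R}$ for almost every $x$. An almost invariant sequence for $\mathcal{R}$ is a sequence of measurable sets $A_n\subset X$ with $\mu(A_n \,\Delta\, gA_n)\to 0$ for all $g\in[\mathcal{R}]$; it is trivial if $\mu(A_n)(1-\mu(A_n))\to 0$. $\mathcal{R}$ is strongly ergodic if it has no non-trivial almost invariant sequence. A non-singular action of a countable group is strongly ergodic if its orbit equivalence relation is. Two non-singular actions $\Gamma\curvearrowright(X,\mu)$ and $\Lambda\curvearrowright(Y,\lambda)$ of countable groups are orbit equivalent if there is a non-singular Borel isomorphism of measure spaces $\theta : X\to Y$ such that $\theta(\Gamma x)=\Lambda\theta(x)$ for almost every $x\in X$. *)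

theory Defs
  imports "HOL-Probability.Probability" "HOL-Algebra.Group_Action"
begin

section \<open>Locally compact second countable groups\<close>

locale topological_group = group G for G (structure) +
  fixes T :: "'a topology"
  assumes topspace_eq_carrier: "topspace T = carrier G"
    and continuous_mult: "continuous_map (prod_topology T T) T (\<lambda>(x, y). x \<otimes> y)"
    and continuous_inv: "continuous_map T T (\<lambda>x. inv x)"

text \<open>Locally compact groups are Hausdorff by the usual convention.\<close>

locale lcsc_group = topological_group +
  assumes Hausdorff: "Hausdorff_space T"
    and locally_compact: "locally_compact_space T"
    and second_countable_top: "second_countable T"

definition topological_group_isomorphic ::
  "('a, 'm) monoid_scheme \<Rightarrow> 'a topology \<Rightarrow> ('b, 'n) monoid_scheme \<Rightarrow> 'b topology \<Rightarrow> bool" where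
  "topological_group_isomorphic G T H S \<longleftrightarrow> (\<exists>f \<in> iso G H. homeomorphic_map T S f)"

definition dense_in :: "'a topology \<Rightarrow> 'a set \<Rightarrow> bool" where
  "dense_in T D \<longleftrightarrow> D \<subseteq> topspace T \<and> T closure_of D = topspace T"


section \<open>Haar measure\<close>

text \<open>
  No regularity condition is imposed: every Borel measure that is finite on compact sets is
  automatically regular on a locally compact second countable Hausdorff space.
\<close>

definition left_haar_measure ::
  "('a, 'm) monoid_scheme \<Rightarrow> 'a topology \<Rightarrow> 'a measure \<Rightarrow> bool" where
  "left_haar_measure G T M \<longleftrightarrow>
     space M = topspace T \<and>
     sets M = sigma_sets (topspace T) {U. openin T U} \<and>
     (\<forall>K. compactin T K \<longrightarrow> emeasure M K < \<infinity>) \<and>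
     emeasure M (space M) \<noteq> 0 \<and>
     (\<forall>g \<in> carrier G. \<forall>A \<in> sets M. emeasure M (g <#\<^bsub>G\<^esub> A) = emeasure M A)"

definition unimodular :: "('a, 'm) monoid_scheme \<Rightarrow> 'a topology \<Rightarrow> bool" where
  "unimodular G T \<longleftrightarrow>
     (\<forall>M. left_haar_measure G T M \<longrightarrow>
        (\<forall>g \<in> carrier G. \<forall>A \<in> sets M. emeasure M (A #>\<^bsub>G\<^esub> g) = emeasure M A))"

definition haar_probability ::
  "('a, 'm) monoid_scheme \<Rightarrow> 'a topology \<Rightarrow> 'a measure \<Rightarrow> bool" where
  "haar_probability G T \<mu> \<longleftrightarrow>
     prob_space \<mu> \<and>
     (\<exists>M. left_haar_measure G T M \<and> sets \<mu> = sets M \<and> null_sets \<mu> = null_sets M)"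


section \<open>Non-singular equivalence relations and actions\<close>

definition nonsingular_iso :: "'a measure \<Rightarrow> 'b measure \<Rightarrow> ('a \<Rightarrow> 'b) \<Rightarrow> bool" where
  "nonsingular_iso M N \<theta> \<longleftrightarrow>
     bij_betw \<theta> (space M) (space N) \<and>
     \<theta> \<in> measurable M N \<and>
     inv_into (space M) \<theta> \<in> measurable N M \<and>
     null_sets (distr M N \<theta>) = null_sets N"

definition full_group :: "'a measure \<Rightarrow> 'a rel \<Rightarrow> ('a \<Rightarrow> 'a) set" where
  "full_group M R = {g. nonsingular_iso M M g \<and> (AE x in M. (g x, x) \<in> R)}"

definition almost_invariant_sequence :: "'a measure \<Rightarrow> 'a rel \<Rightarrow> (nat \<Rightarrow> 'a set) \<Rightarrow> bool" where
  "almost_invariant_sequence M R A \<longleftrightarrow>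
     (\<forall>n. A n \<in> sets M) \<and>
     (\<forall>g \<in> full_group M R. (\<lambda>n. measure M (sym_diff (A n) (g ` A n))) \<longlonglongrightarrow> 0)"

definition strongly_ergodic :: "'a measure \<Rightarrow> 'a rel \<Rightarrow> bool" where
  "strongly_ergodic M R \<longleftrightarrow>
     (\<forall>A. almost_invariant_sequence M R A \<longrightarrow>
        (\<lambda>n. measure M (A n) * (1 - measure M (A n))) \<longlonglongrightarrow> 0)"

definition nonsingular_action ::
  "('g, 'm) monoid_scheme \<Rightarrow> ('g \<Rightarrow> 'a \<Rightarrow> 'a) \<Rightarrow> 'a measure \<Rightarrow> bool" where
  "nonsingular_action \<Gamma> \<phi> M \<longleftrightarrow>
     countable (carrier \<Gamma>) \<and>
     group_action \<Gamma> (space M) \<phi> \<and>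
     (\<forall>g \<in> carrier \<Gamma>. nonsingular_iso M M (\<phi> g))"

definition orbit_relation ::
  "('g, 'm) monoid_scheme \<Rightarrow> ('g \<Rightarrow> 'a \<Rightarrow> 'a) \<Rightarrow> 'a measure \<Rightarrow> 'a rel" where
  "orbit_relation \<Gamma> \<phi> M = {(y, x). x \<in> space M \<and> y \<in> orbit \<Gamma> \<phi> x}"

definition strongly_ergodic_action ::
  "('g, 'm) monoid_scheme \<Rightarrow> ('g \<Rightarrow> 'a \<Rightarrow> 'a) \<Rightarrow> 'a measure \<Rightarrow> bool" where
  "strongly_ergodic_action \<Gamma> \<phi> M \<longleftrightarrow>
     nonsingular_action \<Gamma> \<phi> M \<and> strongly_ergodic M (orbit_relation \<Gamma> \<phi> M)"

definition orbit_equivalent ::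
  "('g, 'm) monoid_scheme \<Rightarrow> ('g \<Rightarrow> 'a \<Rightarrow> 'a) \<Rightarrow> 'a measure \<Rightarrow>
   ('h, 'n) monoid_scheme \<Rightarrow> ('h \<Rightarrow> 'b \<Rightarrow> 'b) \<Rightarrow> 'b measure \<Rightarrow> bool" where
  "orbit_equivalent \<Gamma> \<phi> M \<Lambda> \<psi> N \<longleftrightarrow>
     nonsingular_action \<Gamma> \<phi> M \<and> nonsingular_action \<Lambda> \<psi> N \<and>
     (\<exists>\<theta>. nonsingular_iso M N \<theta> \<and> (AE x in M. \<theta> ` orbit \<Gamma> \<phi> x = orbit \<Lambda> \<psi> (\<theta> x)))"

text \<open>
  The restriction to the carrier is needed because the permutations in \<^const>\<open>BijGroup\<close> are
  extensional functions. Restricting the first argument to a subgroup \<open>\<Gamma>\<close> gives the action of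
  the group \<open>G\<lparr>carrier := \<Gamma>\<rparr>\<close>.
\<close>

definition left_translation :: "('a, 'm) monoid_scheme \<Rightarrow> 'a \<Rightarrow> 'a \<Rightarrow> 'a" where
  "left_translation G g = (\<lambda>x \<in> carrier G. g \<otimes>\<^bsub>G\<^esub> x)"

end

theory Submission
  imports Defs "HOL-Algebra.Weak_Morphisms"
begin

text \<open>
  Let \<open>\<delta>\<close> be the logarithm of the modular function of \<open>G\<close>. If \<open>ker \<delta>\<close> is not open, then suitable
  functions \<open>cos (w \<delta> + \<theta>)\<close> have superlevel sets that form a non-trivial almost invariant sequence.
  Hence \<open>ker \<delta>\<close> is open, and \<open>D = \<delta> G = \<delta> \<Gamma>\<close> is countable. Fix \<open>0 \<noteq> a \<in> D\<close> and consider the open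
  subgroups \<open>G\<^sub>n\<close> of all \<open>x\<close> with \<open>\<delta> x \<in> \<int> n a\<close>. Since \<open>D\<close> and \<open>\<int> n a\<close> are both countably infinite, a bijection
  between them lifts to a bijection \<open>G \<rightarrow> G\<^sub>n\<close> that is a left translation by an element of \<open>\<Gamma>\<close> on each
  coset of \<open>ker \<delta>\<close>, and this is an orbit equivalence between \<open>\<Gamma>\<close> on \<open>G\<close> and \<open>\<Gamma> \<inter> G\<^sub>n\<close> on \<open>G\<^sub>n\<close>. Haar
  measure being unique, \<open>\<delta> G\<^sub>n = \<int> n a\<close> is an isomorphism invariant of \<open>G\<^sub>n\<close>.
\<close>

subsection \<open>Borel sets of topological groups\<close>

text \<open>The cosine works because \<delta> has abelian values: left translation by \<gamma> and
  right translation by x shift \<open>w \<delta>\<close> by the constants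
  \<open>w \<delta> \<gamma>\<close> and \<open>w \<delta> x\<close>. So one needs w with
  \<open>w \<delta> \<gamma>\<close> near multiples of 2 \<pi> for the first n elements of \<Gamma>,
  but \<open>w \<delta> x\<close> near \<pi> for some x near the identity. As \<delta> takes
  arbitrarily small non-zero values there, \<open>\<pi> / \<delta> x\<close> meets the second
  demand, and subtracting one of finitely many frequencies, fixed before x, secures the first at
  little cost to the second. Two obstacles remain. Superlevel sets of almost invariant functions are
  almost invariant only if little mass lies near the level, so the level is chosen anew for each n.
  And the probability measure is merely equivalent to Haar measure, so right translation has to be
  controlled on a compact set. All groups constructed live on the type \<open>real\<close>, where
  only the cardinality of a carrier counts and the topology is transported.\<close>

lemma measurable_continuous_map:
  assumes M: "space M = topspace T" "sets M = sigma_sets (topspace T) {U. openin T U}"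
    and N: "space N = topspace S" "sets N = sigma_sets (topspace S) {U. openin S U}"
    and f: "continuous_map T S f"
  shows "f \<in> measurable M N"
proof (rule measurable_sigma_sets[OF N(2)])
  show "{U. openin S U} \<subseteq> Pow (topspace S)"
    using openin_subset by auto
  show "f \<in> space M \<rightarrow> topspace S"
    using f M(1) by (auto simp: continuous_map_def)
  fix U assume "U \<in> {U. openin S U}"
  then have "openin T {x \<in> topspace T. f x \<in> U}"
    using f by (auto simp: continuous_map_def)
  moreover have "f -` U \<inter> space M = {x \<in> topspace T. f x \<in> U}"
    using M(1) by auto
  ultimately show "f -` U \<inter> space M \<in> sets M"
    unfolding M(2) by (auto intro: sigma_sets.Basic)
qed

text \<open>By second countability \<open>W\<close> is a countable union of open rectangles; without
  it the Borel sets of a product can exceed the product sigma-algebra. Fubini is later applied to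
  maps such as \<open>inv y \<otimes> x\<close>, continuous on the product topology.\<close>

lemma openin_prod_topology_sets_pair_measure:
  assumes M: "sets M = sigma_sets (topspace T) {U. openin T U}"
    and N: "sets N = sigma_sets (topspace S) {U. openin S U}"
    and T: "second_countable T" and S: "second_countable S"
    and W: "openin (prod_topology T S) W"
  shows "W \<in> sets (M \<Otimes>\<^sub>M N)"
proof -
  obtain \<B> where \<B>: "countable \<B>" "\<And>V. V \<in> \<B> \<Longrightarrow> openin T V"
    "\<And>U x. openin T U \<Longrightarrow> x \<in> U \<Longrightarrow> \<exists>V\<in>\<B>. x \<in> V \<and> V \<subseteq> U"
    using T unfolding second_countable_def by meson
  obtain \<C> where \<C>: "countable \<C>" "\<And>V. V \<in> \<C> \<Longrightarrow> openin S V"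
    "\<And>U x. openin S U \<Longrightarrow> x \<in> U \<Longrightarrow> \<exists>V\<in>\<C>. x \<in> V \<and> V \<subseteq> U"
    using S unfolding second_countable_def by meson
  let ?I = "{p \<in> \<B> \<times> \<C>. fst p \<times> snd p \<subseteq> W}"
  have "W = (\<Union>p\<in>?I. fst p \<times> snd p)"
  proof (intro equalityI subsetI)
    fix z assume z: "z \<in> W"
    obtain x y where xy: "z = (x, y)" by force
    obtain U V where UV: "openin T U" "openin S V" "x \<in> U" "y \<in> V" "U \<times> V \<subseteq> W"
      using W z unfolding openin_prod_topology_alt xy by meson
    obtain U' V' where "U' \<in> \<B>" "x \<in> U'" "U' \<subseteq> U" "V' \<in> \<C>" "y \<in> V'" "V' \<subseteq> V"
      using \<B>(3)[OF UV(1,3)] \<C>(3)[OF UV(2,4)] by meson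
    then have "(U', V') \<in> ?I" "z \<in> U' \<times> V'"
      using UV(5) xy by auto
    then show "z \<in> (\<Union>p\<in>?I. fst p \<times> snd p)"
      by (intro UN_I[where a="(U', V')"]) simp_all
  qed auto
  moreover have "countable ?I"
    using \<B>(1) \<C>(1) by (intro countable_subset[of ?I "\<B> \<times> \<C>"]) auto
  moreover have "fst p \<times> snd p \<in> sets (M \<Otimes>\<^sub>M N)" if "p \<in> ?I" for p
    using that \<B>(2) \<C>(2) M N by (intro pair_measureI) (auto intro: sigma_sets.Basic)
  ultimately show ?thesis
    by (metis (no_types, lifting) sets.countable_UN'')
qed

lemma measurable_pair_continuous_map:
  assumes M: "space M = topspace T" "sets M = sigma_sets (topspace T) {U. openin T U}"
    and N: "space N = topspace S" "sets N = sigma_sets (topspace S) {U. openin S U}"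
    and L: "space L = topspace Z" "sets L = sigma_sets (topspace Z) {U. openin Z U}"
    and T: "second_countable T" and S: "second_countable S"
    and f: "continuous_map (prod_topology T S) Z f"
  shows "f \<in> measurable (M \<Otimes>\<^sub>M N) L"
proof (rule measurable_sigma_sets[OF L(2)])
  show "{U. openin Z U} \<subseteq> Pow (topspace Z)"
    using openin_subset by auto
  show "f \<in> space (M \<Otimes>\<^sub>M N) \<rightarrow> topspace Z"
    using f M(1) N(1) by (auto simp: continuous_map_def space_pair_measure)
  fix U assume "U \<in> {U. openin Z U}"
  then have "openin (prod_topology T S) {x \<in> topspace (prod_topology T S). f x \<in> U}"
    using f by (auto simp: continuous_map_def)
  moreover have "f -` U \<inter> space (M \<Otimes>\<^sub>M N) = {x \<in> topspace (prod_topology T S). f x \<in> U}"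
    using M(1) N(1) by (auto simp: space_pair_measure)
  ultimately show "f -` U \<inter> space (M \<Otimes>\<^sub>M N) \<in> sets (M \<Otimes>\<^sub>M N)"
    using openin_prod_topology_sets_pair_measure[OF M(2) N(2) T S] by simp
qed

section \<open>Cosets and translations in topological groups\<close>

context topological_group
begin

lemma l_coset_eq_vimage:
  assumes "g \<in> carrier G" "A \<subseteq> carrier G"
  shows "g <# A = {x \<in> carrier G. inv g \<otimes> x \<in> A}"
proof (intro equalityI subsetI)
  fix x assume "x \<in> g <# A"
  then obtain a where "a \<in> A" "x = g \<otimes> a" by (auto simp: l_coset_def)
  then show "x \<in> {x \<in> carrier G. inv g \<otimes> x \<in> A}"
    using assms by (auto simp: m_assoc[symmetric] subset_eq)
next
  fix x assume "x \<in> {x \<in> carrier G. inv g \<otimes> x \<in> A}"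
  then have "x \<in> carrier G" "inv g \<otimes> x \<in> A" "x = g \<otimes> (inv g \<otimes> x)"
    using assms by (auto simp: m_assoc[symmetric])
  then show "x \<in> g <# A" by (auto simp: l_coset_def)
qed

lemma r_coset_eq_vimage:
  assumes "g \<in> carrier G" "A \<subseteq> carrier G"
  shows "A #> g = {x \<in> carrier G. x \<otimes> inv g \<in> A}"
proof (intro equalityI subsetI)
  fix x assume "x \<in> A #> g"
  then obtain a where "a \<in> A" "x = a \<otimes> g" by (auto simp: r_coset_def)
  then show "x \<in> {x \<in> carrier G. x \<otimes> inv g \<in> A}"
    using assms by (auto simp: m_assoc subset_eq)
next
  fix x assume "x \<in> {x \<in> carrier G. x \<otimes> inv g \<in> A}"
  then have "x \<in> carrier G" "x \<otimes> inv g \<in> A" "x = (x \<otimes> inv g) \<otimes> g"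
    using assms by (auto simp: m_assoc)
  then show "x \<in> A #> g" by (auto simp: r_coset_def)
qed

lemma continuous_map_group_mult:
  assumes "continuous_map X T f" "continuous_map X T g"
  shows "continuous_map X T (\<lambda>x. f x \<otimes> g x)"
proof -
  have "continuous_map X (prod_topology T T) (\<lambda>x. (f x, g x))"
    using assms by (simp add: continuous_map_pairedI)
  from continuous_map_compose[OF this continuous_mult] show ?thesis
    by (simp add: o_def)
qed

lemma continuous_map_group_inv:
  "continuous_map X T f \<Longrightarrow> continuous_map X T (\<lambda>x. inv (f x))"
  using continuous_map_compose[OF _ continuous_inv] by (auto simp: o_def)

lemma continuous_map_l_mult: "g \<in> carrier G \<Longrightarrow> continuous_map T T (\<lambda>x. g \<otimes> x)"
  using continuous_map_group_mult[of T "\<lambda>_. g" "\<lambda>x. x"] topspace_eq_carrier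
  by (simp add: continuous_map_const)

lemma continuous_map_r_mult: "g \<in> carrier G \<Longrightarrow> continuous_map T T (\<lambda>x. x \<otimes> g)"
  using continuous_map_group_mult[of T "\<lambda>x. x" "\<lambda>_. g"] topspace_eq_carrier
  by (simp add: continuous_map_const)

lemma openin_l_coset:
  assumes "g \<in> carrier G" "openin T U"
  shows "openin T (g <# U)"
proof -
  have "openin T {x \<in> topspace T. inv g \<otimes> x \<in> U}"
    using continuous_map_l_mult[of "inv g"] assms by (auto simp: continuous_map_def)
  then show ?thesis
    using l_coset_eq_vimage[OF assms(1)] openin_subset[OF assms(2)] topspace_eq_carrier by simp
qed

lemma openin_inv_vimage:
  assumes "openin T U"
  shows "openin T {x \<in> carrier G. inv x \<in> U}"
  using continuous_inv assms topspace_eq_carrier by (auto simp: continuous_map_def)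

text \<open>The \<open>d\<close> with \<open>inv d \<otimes> x \<in> V\<close> form an open set,
  which contains \<open>x \<otimes> inv v\<close> and therefore meets \<open>D\<close>. With
  \<open>D\<close> countable, translates of one open set control the whole group, which yields
  positivity of Haar measure on open sets and sigma-finiteness.\<close>

lemma Union_l_cosets_dense:
  assumes "dense_in T D" "openin T V" "V \<noteq> {}"
  shows "(\<Union>d\<in>D. d <# V) = carrier G"
proof (intro equalityI subsetI)
  have D: "D \<subseteq> carrier G" using assms(1) topspace_eq_carrier by (auto simp: dense_in_def)
  have V: "V \<subseteq> carrier G" using openin_subset[OF assms(2)] topspace_eq_carrier by simp
  show "x \<in> carrier G" if "x \<in> (\<Union>d\<in>D. d <# V)" for x
    using that D l_coset_eq_vimage[OF _ V] by blast
  fix x assume x: "x \<in> carrier G"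
  obtain v where v: "v \<in> V" using assms by auto
  let ?W = "{y \<in> carrier G. inv y \<otimes> x \<in> V}"
  have "continuous_map T T (\<lambda>y. inv y \<otimes> x)"
    using continuous_map_group_mult[OF continuous_inv] x topspace_eq_carrier
    by (simp add: continuous_map_const)
  then have "openin T ?W"
    using assms(2) topspace_eq_carrier by (auto simp: continuous_map_def)
  moreover have "x \<otimes> inv v \<in> ?W"
    using v V x by (auto simp: subset_eq inv_mult_group m_assoc)
  ultimately obtain d where "d \<in> D" "d \<in> ?W"
    using assms(1) topspace_eq_carrier x unfolding dense_in_def
    by (metis (no_types, lifting) dense_intersects_open disjoint_iff empty_iff)
  then show "x \<in> (\<Union>d\<in>D. d <# V)"
    using l_coset_eq_vimage[OF _ V] x by blast
qed

end

context lcsc_group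
begin

lemma ex_countable_dense: "\<exists>D. countable D \<and> dense_in T D"
  using second_countable_imp_separable_space[OF second_countable_top]
  unfolding separable_space_def dense_in_def by auto

lemma ex_compact_nhd: "\<exists>U K. openin T U \<and> compactin T K \<and> \<one> \<in> U \<and> U \<subseteq> K"
  using locally_compact topspace_eq_carrier unfolding locally_compact_space_def by auto

end

subsection \<open>Uniqueness of Haar measure\<close>

locale haar_group = lcsc_group G T for G (structure) and T +
  fixes M
  assumes haar: "left_haar_measure G T M"
begin

lemma space_M [simp]: "space M = carrier G"
  using haar topspace_eq_carrier by (simp add: left_haar_measure_def)

lemma sets_M: "sets M = sigma_sets (topspace T) {U. openin T U}"
  using haar by (simp add: left_haar_measure_def)

lemma open_sets [measurable (raw)]: "openin T U \<Longrightarrow> U \<in> sets M"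
  by (simp add: sets_M sigma_sets.Basic)

lemma sets_subset_carrier: "A \<in> sets M \<Longrightarrow> A \<subseteq> carrier G"
  using sets.sets_into_space[of A M] by simp

lemma compact_sets: "compactin T K \<Longrightarrow> K \<in> sets M"
proof -
  assume K: "compactin T K"
  then have "closedin T K"
    using Hausdorff compactin_imp_closedin by blast
  then have "topspace T - (topspace T - K) \<in> sets M"
    by (intro sets.Diff open_sets) auto
  then show ?thesis
    using compactin_subset_topspace[OF K] by (simp add: double_diff)
qed

lemma emeasure_compact_finite: "compactin T K \<Longrightarrow> emeasure M K < \<infinity>"
  using haar by (auto simp: left_haar_measure_def)

lemma emeasure_space_nonzero: "emeasure M (carrier G) \<noteq> 0"
  using haar topspace_eq_carrier by (simp add: left_haar_measure_def)

lemma measurable_continuous: "continuous_map T T f \<Longrightarrow> f \<in> measurable M M"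
  using measurable_continuous_map[of M T M T f] topspace_eq_carrier sets_M by simp

lemma measurable_l_mult: "g \<in> carrier G \<Longrightarrow> (\<lambda>x. g \<otimes> x) \<in> measurable M M"
  by (intro measurable_continuous continuous_map_l_mult)

lemma measurable_r_mult: "g \<in> carrier G \<Longrightarrow> (\<lambda>x. x \<otimes> g) \<in> measurable M M"
  by (intro measurable_continuous continuous_map_r_mult)

lemma measurable_inv: "(\<lambda>x. inv x) \<in> measurable M M"
  by (intro measurable_continuous continuous_inv)

lemma vimage_sets: "f \<in> measurable M M \<Longrightarrow> A \<in> sets M \<Longrightarrow> {x \<in> carrier G. f x \<in> A} \<in> sets M"
  using measurable_sets[of f M M A] by (simp add: vimage_def Int_def conj_commute)

lemma l_coset_sets: "g \<in> carrier G \<Longrightarrow> A \<in> sets M \<Longrightarrow> g <# A \<in> sets M"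
  using vimage_sets[OF measurable_l_mult[of "inv g"]] l_coset_eq_vimage sets_subset_carrier by simp

lemma r_coset_sets: "g \<in> carrier G \<Longrightarrow> A \<in> sets M \<Longrightarrow> A #> g \<in> sets M"
  using vimage_sets[OF measurable_r_mult[of "inv g"]] r_coset_eq_vimage sets_subset_carrier by simp

lemma emeasure_l_coset: "g \<in> carrier G \<Longrightarrow> A \<in> sets M \<Longrightarrow> emeasure M (g <# A) = emeasure M A"
  using haar by (auto simp: left_haar_measure_def)

lemma emeasure_l_vimage:
  assumes "g \<in> carrier G" "A \<in> sets M"
  shows "emeasure M {x \<in> carrier G. g \<otimes> x \<in> A} = emeasure M A"
  using emeasure_l_coset[of "inv g" A] l_coset_eq_vimage[of "inv g" A] sets_subset_carrier assms by simp

lemma distr_l_mult: "g \<in> carrier G \<Longrightarrow> distr M M (\<lambda>x. g \<otimes> x) = M"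
proof (rule measure_eqI)
  fix A assume g: "g \<in> carrier G" and "A \<in> sets (distr M M (\<lambda>x. g \<otimes> x))"
  then have A: "A \<in> sets M" by simp
  have "(\<lambda>x. g \<otimes> x) -` A \<inter> space M = {x \<in> carrier G. g \<otimes> x \<in> A}" by auto
  then show "emeasure (distr M M (\<lambda>x. g \<otimes> x)) A = emeasure M A"
    using emeasure_distr[OF measurable_l_mult[OF g] A] emeasure_l_vimage[OF g A] by simp
qed simp

lemma nn_integral_l_mult:
  assumes "g \<in> carrier G" "f \<in> borel_measurable M"
  shows "(\<integral>\<^sup>+x. f (g \<otimes> x) \<partial>M) = (\<integral>\<^sup>+x. f x \<partial>M)"
  using nn_integral_distr[OF measurable_l_mult[OF assms(1)], of f] distr_l_mult assms by simp

lemma emeasure_open_pos: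
  assumes "openin T U" "U \<noteq> {}"
  shows "emeasure M U > 0"
proof (rule ccontr)
  assume "\<not> ?thesis"
  then have z: "emeasure M U = 0" by (simp add: not_gr_zero)
  obtain D where D: "countable D" "dense_in T D" using ex_countable_dense by blast
  then have DG: "D \<subseteq> carrier G" using topspace_eq_carrier by (auto simp: dense_in_def)
  have "(\<Union>d\<in>D. d <# U) \<in> null_sets M"
    using D(1) DG z assms(1) emeasure_l_coset l_coset_sets open_sets
    by (intro null_sets_UN') (auto simp: null_sets_def subset_eq)
  then show False
    using Union_l_cosets_dense[OF D(2) assms] emeasure_space_nonzero by auto
qed

sublocale sigma_finite_measure M
proof
  obtain U K where UK: "openin T U" "compactin T K" "\<one> \<in> U" "U \<subseteq> K" using ex_compact_nhd by blast
  obtain D where D: "countable D" "dense_in T D" using ex_countable_dense by blast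
  then have DG: "D \<subseteq> carrier G" using topspace_eq_carrier by (auto simp: dense_in_def)
  have "emeasure M U \<le> emeasure M K" using UK compact_sets by (intro emeasure_mono) auto
  also have "\<dots> < \<infinity>" using UK emeasure_compact_finite by simp
  finally have fin: "emeasure M U < \<infinity>" .
  let ?A = "(\<lambda>d. d <# U) ` D"
  have "countable ?A" using D by simp
  moreover have "?A \<subseteq> sets M" using DG l_coset_sets open_sets UK(1) by auto
  moreover have "\<Union> ?A = space M" using Union_l_cosets_dense[OF D(2) UK(1)] UK(3) by auto
  moreover have "\<forall>a\<in>?A. emeasure M a \<noteq> \<infinity>"
    using emeasure_l_coset fin DG UK(1) open_sets by auto
  ultimately show "\<exists>A. countable A \<and> A \<subseteq> sets M \<and> \<Union> A = space M \<and> (\<forall>a\<in>A. emeasure M a \<noteq> \<infinity>)"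
    by blast
qed

lemma ex_sets_pos_finite: "\<exists>A\<in>sets M. emeasure M A > 0 \<and> emeasure M A < \<infinity>"
proof -
  obtain U K where UK: "openin T U" "compactin T K" "\<one> \<in> U" "U \<subseteq> K" using ex_compact_nhd by blast
  have "emeasure M U \<le> emeasure M K" using UK compact_sets by (intro emeasure_mono) auto
  also have "\<dots> < \<infinity>" using UK emeasure_compact_finite by simp
  finally show ?thesis using UK open_sets emeasure_open_pos by blast
qed

end

section \<open>Comparison of two Haar measures, possibly equal, by Fubini\<close>

locale two_haar = A: haar_group G T M + B: haar_group G T N for G (structure) and T M N
begin

lemma sets_eq: "sets N = sets M"
  using A.sets_M B.sets_M by simp

sublocale P: pair_sigma_finite M N ..

lemma measurable_pair_continuous:
  assumes "continuous_map (prod_topology T T) T f"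
  shows "f \<in> measurable (M \<Otimes>\<^sub>M N) M"
  using measurable_pair_continuous_map[of M T N T M T f] A.second_countable_top assms
    A.topspace_eq_carrier A.sets_M B.sets_M by simp

text \<open>Integrate the indicator of \<open>E\<close> at \<open>inv y \<otimes> x\<close> over the
  product. Integrating over \<open>x\<close> first gives the \<open>M\<close>-measure of
  \<open>E\<close> times the total \<open>N\<close>-measure. Integrating over \<open>y\<close>
  first, the substitution of \<open>x \<otimes> y\<close> for \<open>y\<close> leaves
  \<open>inv y\<close>, so each inner integral is the \<open>N\<close>-measure of the inverse of
  \<open>E\<close>, which is 0.\<close>

lemma emeasure_inv_null:
  assumes E: "E \<in> sets M" and null: "emeasure N {x \<in> carrier G. inv x \<in> E} = 0"
  shows "emeasure M E = 0"
proof -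
  have "continuous_map (prod_topology T T) T (\<lambda>z. inv (snd z) \<otimes> fst z)"
    by (intro A.continuous_map_group_mult A.continuous_map_group_inv continuous_map_fst continuous_map_snd)
  from measurable_pair_continuous[OF this]
  have m: "(\<lambda>z. indicator E (inv (snd z) \<otimes> fst z) :: ennreal) \<in> borel_measurable (M \<Otimes>\<^sub>M N)"
    using measurable_compose[of _ _ M "indicator E :: _ \<Rightarrow> ennreal"] E by (auto simp: o_def)
  have "emeasure M E * emeasure N (carrier G) = (\<integral>\<^sup>+y. (\<integral>\<^sup>+x. indicator E x \<partial>M) \<partial>N)"
    using E by simp
  also have "\<dots> = (\<integral>\<^sup>+y. (\<integral>\<^sup>+x. indicator E (inv y \<otimes> x) \<partial>M) \<partial>N)"
    using E by (intro nn_integral_cong A.nn_integral_l_mult[symmetric]) auto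
  also have "\<dots> = (\<integral>\<^sup>+x. (\<integral>\<^sup>+y. indicator E (inv y \<otimes> x) \<partial>N) \<partial>M)"
    using P.Fubini'[of "\<lambda>x y. indicator E (inv y \<otimes> x)"] m by (simp add: split_beta)
  also have "\<dots> = (\<integral>\<^sup>+x. (\<integral>\<^sup>+y. indicator {x \<in> carrier G. inv x \<in> E} y \<partial>N) \<partial>M)"
  proof (rule nn_integral_cong)
    fix x assume "x \<in> space M"
    then have x: "x \<in> carrier G" by simp
    have cont: "continuous_map T T (\<lambda>y. inv y \<otimes> x)"
      using A.continuous_map_group_mult[OF A.continuous_inv] x A.topspace_eq_carrier
      by (simp add: continuous_map_const)
    have "(indicator E :: _ \<Rightarrow> ennreal) \<in> borel_measurable N"
      using E sets_eq by simp
    from measurable_compose[OF B.measurable_continuous[OF cont] this]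
    have mx: "(\<lambda>y. indicator E (inv y \<otimes> x) :: ennreal) \<in> borel_measurable N" .
    have "(\<integral>\<^sup>+y. indicator E (inv y \<otimes> x) \<partial>N) = (\<integral>\<^sup>+y. indicator E (inv (x \<otimes> y) \<otimes> x) \<partial>N)"
      using B.nn_integral_l_mult[OF x mx] by simp
    also have "\<dots> = (\<integral>\<^sup>+y. indicator {x \<in> carrier G. inv x \<in> E} y \<partial>N)"
      using x by (intro nn_integral_cong)
        (auto simp: A.inv_mult_group A.m_assoc indicator_def)
    finally show "(\<integral>\<^sup>+y. indicator E (inv y \<otimes> x) \<partial>N) = (\<integral>\<^sup>+y. indicator {x \<in> carrier G. inv x \<in> E} y \<partial>N)" .
  qed
  also have "\<dots> = 0"
    using null B.vimage_sets[OF B.measurable_inv, of E] E sets_eq by simp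
  finally show ?thesis using B.emeasure_space_nonzero by simp
qed

end

context haar_group
begin

text \<open>Inversion is used twice. One measure paired with itself shows that the inverse of a null
  set is null; pairing it with the other measure then brings the set back as a null set of the
  latter.\<close>

lemma null_sets_haar:
  assumes N: "left_haar_measure G T N"
  shows "null_sets M = null_sets N"
proof -
  have *: "null_sets N1 \<subseteq> null_sets N2" if "left_haar_measure G T N1" "left_haar_measure G T N2" for N1 N2
  proof
    interpret A: haar_group G T N1 by standard fact
    interpret B: haar_group G T N2 by standard fact
    interpret AA: two_haar G T N1 N1 ..
    interpret BA: two_haar G T N2 N1 ..
    fix E assume E: "E \<in> null_sets N1"
    then have E': "E \<in> sets N1" "emeasure N1 E = 0" by auto
    let ?I = "{x \<in> carrier G. inv x \<in> E}"
    have "?I \<in> sets N1" using A.vimage_sets[OF A.measurable_inv] E' by auto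
    moreover have "{x \<in> carrier G. inv x \<in> ?I} = E"
      using A.sets_subset_carrier[OF E'(1)] by auto
    ultimately have "emeasure N1 ?I = 0"
      using AA.emeasure_inv_null E' by simp
    then have "emeasure N2 E = 0"
      using BA.emeasure_inv_null E' BA.sets_eq by simp
    then show "E \<in> null_sets N2" using E' BA.sets_eq by auto
  qed
  show ?thesis using *[OF haar N] *[OF N haar] by blast
qed

lemma haar_right_translate:
  assumes g: "g \<in> carrier G"
  shows "left_haar_measure G T (distr M M (\<lambda>x. x \<otimes> g))"
proof -
  let ?N = "distr M M (\<lambda>x. x \<otimes> g)"
  have em: "emeasure ?N A = emeasure M (A #> inv g)" if A: "A \<in> sets M" for A
  proof -
    have "(\<lambda>x. x \<otimes> g) -` A \<inter> space M = A #> inv g"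
      using r_coset_eq_vimage[of "inv g" A] g sets_subset_carrier[OF A] by auto
    then show ?thesis using emeasure_distr[OF measurable_r_mult[OF g] A] by simp
  qed
  have "emeasure ?N K < \<infinity>" if K: "compactin T K" for K
  proof -
    have "compactin T ((\<lambda>x. x \<otimes> inv g) ` K)"
      using image_compactin[OF K] continuous_map_r_mult[of "inv g"] g by simp
    moreover have "(\<lambda>x. x \<otimes> inv g) ` K = K #> inv g" by (auto simp: r_coset_def)
    ultimately show ?thesis using em[OF compact_sets[OF K]] emeasure_compact_finite by simp
  qed
  moreover have "emeasure ?N (space ?N) \<noteq> 0"
  proof -
    have "carrier G #> inv g = carrier G"
      using r_coset_eq_vimage[of "inv g" "carrier G"] g by auto
    then show ?thesis using em[OF sets.top] emeasure_space_nonzero by simp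
  qed
  moreover have "emeasure ?N (h <# A) = emeasure ?N A" if h: "h \<in> carrier G" and A: "A \<in> sets M" for h A
  proof -
    have "h <# A #> inv g = h <# (A #> inv g)"
      using coset_assoc[of h "inv g" A] sets_subset_carrier[OF A] g h by simp
    then show ?thesis
      using em[OF A] em[OF l_coset_sets[OF h A]] emeasure_l_coset[OF h, of "A #> inv g"]
        r_coset_sets[of "inv g" A] g A by simp
  qed
  ultimately show ?thesis
    unfolding left_haar_measure_def using sets_M topspace_eq_carrier by simp
qed

lemma r_vimage_null:
  assumes g: "g \<in> carrier G" and E: "E \<in> null_sets M"
  shows "{x \<in> carrier G. x \<otimes> g \<in> E} \<in> null_sets M"
proof -
  have "E \<in> null_sets (distr M M (\<lambda>x. x \<otimes> g))"
    using null_sets_haar[OF haar_right_translate[OF g]] E by simp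
  then have "(\<lambda>x. x \<otimes> g) -` E \<inter> space M \<in> null_sets M"
    using null_sets_distr_iff[OF measurable_r_mult[OF g]] by simp
  moreover have "(\<lambda>x. x \<otimes> g) -` E \<inter> space M = {x \<in> carrier G. x \<otimes> g \<in> E}" by auto
  ultimately show ?thesis by simp
qed

text \<open>
  The density of one Haar measure with respect to another is invariant almost everywhere under each
  left translation. By Fubini, it agrees almost everywhere with its value at almost every point.
\<close>

lemma haar_unique:
  assumes N: "left_haar_measure G T N"
  shows "\<exists>c::real. 0 < c \<and> (\<forall>A\<in>sets M. emeasure N A = ennreal c * emeasure M A)"
proof -
  interpret B: haar_group G T N by standard fact
  interpret AB: two_haar G T M N ..
  interpret AA: two_haar G T M M ..
  have ac: "absolutely_continuous M N"
    using null_sets_haar[OF N] by (simp add: absolutely_continuous_def)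
  define f where "f = RN_deriv M N"
  have f[measurable]: "f \<in> borel_measurable M" by (simp add: f_def)
  have dens: "density M f = N"
    unfolding f_def using density_RN_deriv[OF ac AB.sets_eq] .
  have inv: "AE x in M. f (g \<otimes> x) = f x" if g: "g \<in> carrier G" for g
  proof -
    have m: "(\<lambda>x. f (g \<otimes> x)) \<in> borel_measurable M"
      using measurable_compose[OF measurable_l_mult[OF g] f] .
    \<comment> \<open>Both measures are left invariant, so the translated density represents
      \<open>N\<close> as well, and densities are unique almost everywhere.\<close>
    have "density M (\<lambda>x. f (g \<otimes> x)) = N"
    proof (rule measure_eqI)
      fix A assume "A \<in> sets (density M (\<lambda>x. f (g \<otimes> x)))"
      then have A: "A \<in> sets M" by simp
      have gA: "g <# A \<in> sets M" using l_coset_sets[OF g A] .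
      have ind: "indicator (g <# A) (g \<otimes> x) = (indicator A x :: ennreal)" if "x \<in> carrier G" for x
        using l_coset_eq_vimage[OF g sets_subset_carrier[OF A]] g that
        by (auto simp: indicator_def m_assoc[symmetric])
      have "emeasure (density M (\<lambda>x. f (g \<otimes> x))) A = (\<integral>\<^sup>+x. f (g \<otimes> x) * indicator A x \<partial>M)"
        using emeasure_density[OF m A] .
      also have "\<dots> = (\<integral>\<^sup>+x. f (g \<otimes> x) * indicator (g <# A) (g \<otimes> x) \<partial>M)"
        using ind by (intro nn_integral_cong) simp
      also have "\<dots> = (\<integral>\<^sup>+x. f x * indicator (g <# A) x \<partial>M)"
        using nn_integral_l_mult[OF g, of "\<lambda>x. f x * indicator (g <# A) x"] f gA by simp
      also have "\<dots> = emeasure N (g <# A)"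
        using emeasure_density[OF f gA] dens by simp
      also have "\<dots> = emeasure N A"
        using B.emeasure_l_coset[OF g] A AB.sets_eq by simp
      finally show "emeasure (density M (\<lambda>x. f (g \<otimes> x))) A = emeasure N A" .
    qed (simp add: AB.sets_eq)
    then show ?thesis
      using density_unique[OF m f] dens by simp
  qed
  have m: "(\<lambda>z. f (fst z \<otimes> snd z)) \<in> borel_measurable (M \<Otimes>\<^sub>M M)"
  proof -
    have "continuous_map (prod_topology T T) T (\<lambda>z. fst z \<otimes> snd z)"
      by (intro continuous_map_group_mult continuous_map_fst continuous_map_snd)
    from measurable_compose[OF AA.measurable_pair_continuous[OF this] f] show ?thesis .
  qed
  have "AE x in M. AE g in M. f (g \<otimes> x) = f x"
  proof -
    have "{z \<in> space (M \<Otimes>\<^sub>M M). f (fst z \<otimes> snd z) = f (snd z)} \<in> sets (M \<Otimes>\<^sub>M M)"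
      using m by measurable
    then show ?thesis
      using AA.P.AE_commute[of "\<lambda>g x. f (g \<otimes> x) = f x"] inv by (auto intro: AE_I2)
  qed
  then obtain x where x: "x \<in> carrier G" and ae: "AE g in M. f (g \<otimes> x) = f x"
  proof -
    have "\<not> (AE x in M. False)"
      using emeasure_space_nonzero AE_iff_measurable[of "space M" M "\<lambda>_. False"] sets.top[of M] by simp
    moreover have "AE x in M. False" if "\<forall>x\<in>carrier G. \<not> (AE g in M. f (g \<otimes> x) = f x)"
      using \<open>AE x in M. AE g in M. f (g \<otimes> x) = f x\<close> AE_space
      by eventually_elim (use that in auto)
    ultimately show ?thesis using that by blast
  qed
  have "AE y in M. f y = f x"
  proof -
    let ?Z = "{g \<in> carrier G. f (g \<otimes> x) \<noteq> f x}"
    have "(\<lambda>g. f (g \<otimes> x)) \<in> borel_measurable M"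
      using measurable_compose[OF measurable_r_mult[OF x] f] .
    then have "{g \<in> space M. f (g \<otimes> x) \<noteq> f x} \<in> sets M" by measurable
    then have "?Z \<in> null_sets M" using ae AE_iff_null[of M "\<lambda>g. f (g \<otimes> x) = f x"] by simp
    \<comment> \<open>Right translation by \<open>x\<close> carries the null set of exceptional
      \<open>g\<close> to the set of exceptional \<open>y = g \<otimes> x\<close>, and right
      translations preserve null sets.\<close>
    from r_vimage_null[OF inv_closed[OF x] this]
    have "{y \<in> carrier G. y \<otimes> inv x \<in> ?Z} \<in> null_sets M" .
    moreover have "{y \<in> carrier G. y \<otimes> inv x \<in> ?Z} = {y \<in> space M. f y \<noteq> f x}"
      using x by (auto simp: m_assoc)
    ultimately show ?thesis by (intro AE_I'[of "{y \<in> space M. f y \<noteq> f x}"]) simp_all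
  qed
  then have "density M f = density M (\<lambda>_. f x)"
    by (intro density_cong) auto
  then have em: "emeasure N A = f x * emeasure M A" if "A \<in> sets M" for A
    using dens that emeasure_density[of "\<lambda>_. f x" M A]
    by (metis borel_measurable_const nn_integral_cmult_indicator)
  \<comment> \<open>The constant \<open>f x\<close> is a priori an extended real; a set of positive
    finite \<open>N\<close>-measure rules out both 0 and infinity.\<close>
  obtain A where A: "A \<in> sets N" "emeasure N A > 0" "emeasure N A < \<infinity>" using B.ex_sets_pos_finite by blast
  obtain A' where A': "A' \<in> sets M" "emeasure M A' > 0" "emeasure M A' < \<infinity>" using ex_sets_pos_finite by blast
  have "f x \<noteq> 0" using em[of A] A AB.sets_eq by auto
  have "f x \<noteq> \<infinity>"
  proof
    assume "f x = \<infinity>"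
    then have "emeasure N A = \<infinity> * emeasure M A" using em[of A] A(1) AB.sets_eq by simp
    then show False using A(2,3) by (cases "emeasure M A = 0") (auto simp: ennreal_top_mult)
  qed
  then obtain c where c: "f x = ennreal c" "c \<ge> 0" by (cases "f x") auto
  have "c \<noteq> 0" using c(1) \<open>f x \<noteq> 0\<close> by (metis ennreal_0)
  then show ?thesis using em c by (intro exI[of _ c]) simp
qed

end

subsection \<open>The modular function\<close>

context haar_group
begin

text \<open>The logarithm makes the modular function a homomorphism into the additive reals, on
  which frequencies act by multiplication.\<close>

definition log_modular :: "'a \<Rightarrow> real" where
  "log_modular g = (THE d. \<forall>A\<in>sets M. emeasure M (A #> g) = ennreal (exp d) * emeasure M A)"

lemma log_modular_eqI:
  assumes d: "\<And>A. A \<in> sets M \<Longrightarrow> emeasure M (A #> g) = ennreal (exp d) * emeasure M A"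
  shows "log_modular g = d"
  unfolding log_modular_def
proof (rule the_equality)
  show "\<forall>A\<in>sets M. emeasure M (A #> g) = ennreal (exp d) * emeasure M A" using d by simp
  fix d' assume d': "\<forall>A\<in>sets M. emeasure M (A #> g) = ennreal (exp d') * emeasure M A"
  obtain A where A: "A \<in> sets M" "emeasure M A > 0" "emeasure M A < \<infinity>" using ex_sets_pos_finite by blast
  then obtain a where a: "emeasure M A = ennreal a" "a > 0"
    by (cases "emeasure M A") (auto simp: ennreal_less_zero_iff)
  have "ennreal (exp d') * ennreal a = ennreal (exp d) * ennreal a"
    using d[OF A(1)] d' A(1) a by simp
  then have "ennreal (exp d' * a) = ennreal (exp d * a)"
    using a by (simp add: ennreal_mult)
  then have "exp d' * a = exp d * a" using a by (subst (asm) ennreal_inj) auto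
  then show "d' = d" using a by simp
qed

lemma emeasure_r_coset:
  assumes g: "g \<in> carrier G" and A: "A \<in> sets M"
  shows "emeasure M (A #> g) = ennreal (exp (log_modular g)) * emeasure M A"
proof -
  let ?N = "distr M M (\<lambda>x. x \<otimes> inv g)"
  have N: "emeasure ?N A = emeasure M (A #> g)" if A: "A \<in> sets M" for A
  proof -
    have "(\<lambda>x. x \<otimes> inv g) -` A \<inter> space M = A #> g"
      using r_coset_eq_vimage[of g A] g sets_subset_carrier[OF A] by auto
    then show ?thesis using emeasure_distr[OF measurable_r_mult[OF inv_closed[OF g]] A] by simp
  qed
  obtain c where c: "c > 0" "\<And>A. A \<in> sets M \<Longrightarrow> emeasure ?N A = ennreal c * emeasure M A"
    using haar_unique[OF haar_right_translate[OF inv_closed[OF g]]] by auto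
  then have "\<And>A. A \<in> sets M \<Longrightarrow> emeasure M (A #> g) = ennreal (exp (ln c)) * emeasure M A"
    using N by simp
  with log_modular_eqI[OF this] A show ?thesis by simp
qed

lemma log_modular_mult:
  assumes g: "g \<in> carrier G" and h: "h \<in> carrier G"
  shows "log_modular (g \<otimes> h) = log_modular g + log_modular h"
proof (rule log_modular_eqI)
  fix A assume A: "A \<in> sets M"
  have "A #> (g \<otimes> h) = A #> g #> h"
    using coset_mult_assoc[OF sets_subset_carrier[OF A] g h] by simp
  then show "emeasure M (A #> (g \<otimes> h)) = ennreal (exp (log_modular g + log_modular h)) * emeasure M A"
    using emeasure_r_coset[OF g A] emeasure_r_coset[OF h r_coset_sets[OF g A]]
    by (simp add: exp_add ennreal_mult mult_ac)
qed

lemma log_modular_one [simp]: "log_modular \<one> = 0"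
  using log_modular_mult[of \<one> \<one>] by simp

lemma log_modular_inv: "g \<in> carrier G \<Longrightarrow> log_modular (inv g) = - log_modular g"
  using log_modular_mult[of g "inv g"] by simp

lemma log_modular_pow: "g \<in> carrier G \<Longrightarrow> log_modular (g [^] (n::nat)) = n * log_modular g"
  by (induction n) (auto simp: log_modular_mult algebra_simps)

section \<open>Continuity of the modular function\<close>

lemma ex_open_squares_subset:
  assumes V: "openin T V" "\<one> \<in> V"
  shows "\<exists>W. openin T W \<and> \<one> \<in> W \<and> W \<subseteq> V \<and> (\<forall>x\<in>W. \<forall>y\<in>W. x \<otimes> y \<in> V)"
proof -
  let ?P = "{z \<in> topspace (prod_topology T T). (case z of (x, y) \<Rightarrow> x \<otimes> y) \<in> V}"
  have op: "openin (prod_topology T T) ?P"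
    using continuous_mult V(1) by (auto simp: continuous_map_def)
  have mem: "(\<one>, \<one>) \<in> ?P"
    using V topspace_eq_carrier by simp
  from op[unfolded openin_prod_topology_alt, rule_format, OF mem]
  obtain W1 W2 where W: "openin T W1" "openin T W2" "\<one> \<in> W1" "\<one> \<in> W2" "W1 \<times> W2 \<subseteq> ?P"
    by blast
  then show ?thesis
    using V by (intro exI[of _ "W1 \<inter> W2 \<inter> V"]) auto
qed

text \<open>For \<open>g\<close> in a compact neighbourhood \<open>K\<close>, the translate of
  \<open>K\<close> by \<open>g\<close> stays in the compact product of \<open>K\<close> with itself,
  which bounds the scaling factor above. Passing to elements whose inverses lie there as well bounds
  it below.\<close>

lemma log_modular_bounded_nhd:
  shows "\<exists>V C. openin T V \<and> \<one> \<in> V \<and> (\<forall>x\<in>V. \<bar>log_modular x\<bar> \<le> C)"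
proof -
  obtain U K where UK: "openin T U" "compactin T K" "\<one> \<in> U" "U \<subseteq> K" using ex_compact_nhd by blast
  have KG: "K \<subseteq> carrier G" using compactin_subset_topspace[OF UK(2)] topspace_eq_carrier by simp
  let ?L = "(\<lambda>(x, y). x \<otimes> y) ` (K \<times> K)"
  have "compactin (prod_topology T T) (K \<times> K)" using UK(2) by (simp add: compactin_Times)
  then have L: "compactin T ?L" using image_compactin continuous_mult by blast
  obtain k where k: "emeasure M K = ennreal k" "k > 0"
  proof -
    have "0 < emeasure M U" using UK emeasure_open_pos by blast
    also have "\<dots> \<le> emeasure M K" using UK compact_sets by (intro emeasure_mono) auto
    finally show ?thesis using emeasure_compact_finite[OF UK(2)] that
      by (cases "emeasure M K") (auto simp: ennreal_less_zero_iff)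
  qed
  obtain l where l: "emeasure M ?L = ennreal l" "l \<ge> 0"
    using emeasure_compact_finite[OF L] by (cases "emeasure M ?L") auto
  have b: "log_modular g \<le> ln (l / k)" if g: "g \<in> K" for g
  proof -
    have "K #> g \<subseteq> ?L" using g by (auto simp: r_coset_def)
    then have "emeasure M (K #> g) \<le> emeasure M ?L"
      using compact_sets[OF L] by (intro emeasure_mono) auto
    then have "ennreal (exp (log_modular g) * k) \<le> ennreal l"
      using emeasure_r_coset[of g K] g KG compact_sets[OF UK(2)] k l by (auto simp: ennreal_mult)
    then have le: "exp (log_modular g) * k \<le> l" using l by (simp add: ennreal_le_iff)
    have "0 < exp (log_modular g) * k" using k by simp
    with le have "l > 0" by linarith
    have "exp (log_modular g) \<le> l / k" using le k by (simp add: field_simps)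
    then have "exp (log_modular g) \<le> exp (ln (l / k))" using k \<open>l > 0\<close> by simp
    then show ?thesis by simp
  qed
  let ?V = "U \<inter> {x \<in> carrier G. inv x \<in> U}"
  have "openin T ?V" "\<one> \<in> ?V" using openin_inv_vimage[OF UK(1)] UK by auto
  moreover have "\<bar>log_modular x\<bar> \<le> ln (l / k)" if "x \<in> ?V" for x
  proof -
    have x: "x \<in> carrier G" "x \<in> K" "inv x \<in> K" using that UK(4) KG by auto
    show ?thesis using b[OF x(2)] b[OF x(3)] log_modular_inv[OF x(1)] by linarith
  qed
  ultimately show ?thesis by blast
qed

text \<open>If the squares of the elements of \<open>W'\<close> lie in \<open>W\<close>, a bound for
  the homomorphism on \<open>W\<close> is halved on \<open>W'\<close>. Local boundedness thus
  improves itself to continuity at the identity.\<close>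

lemma log_modular_small_nhd:
  assumes "e > 0"
  shows "\<exists>V. openin T V \<and> \<one> \<in> V \<and> (\<forall>x\<in>V. \<bar>log_modular x\<bar> < e)"
proof -
  obtain V C where V: "openin T V" "\<one> \<in> V" "\<And>x. x \<in> V \<Longrightarrow> \<bar>log_modular x\<bar> \<le> C"
    using log_modular_bounded_nhd by blast
  have "\<exists>W. openin T W \<and> \<one> \<in> W \<and> (\<forall>x\<in>W. \<bar>log_modular x\<bar> \<le> C / 2 ^ n)" for n
  proof (induction n)
    case 0
    then show ?case using V by auto
  next
    case (Suc n)
    then obtain W where W: "openin T W" "\<one> \<in> W" "\<And>x. x \<in> W \<Longrightarrow> \<bar>log_modular x\<bar> \<le> C / 2 ^ n" by blast
    then obtain W' where W': "openin T W'" "\<one> \<in> W'" "\<And>x y. x \<in> W' \<Longrightarrow> y \<in> W' \<Longrightarrow> x \<otimes> y \<in> W"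
      using ex_open_squares_subset[of W] by blast
    have "\<bar>log_modular x\<bar> \<le> C / 2 ^ Suc n" if "x \<in> W'" for x
    proof -
      have "x \<in> carrier G" using openin_subset[OF W'(1)] that topspace_eq_carrier by auto
      then show ?thesis
        using W(3)[OF W'(3)[OF that that]] log_modular_mult[of x x] by (simp add: field_simps abs_mult)
    qed
    then show ?case using W' by blast
  qed
  moreover obtain n where "C / 2 ^ n < e"
  proof -
    obtain n where "C / e < 2 ^ n" using real_arch_pow[of 2 "C / e"] by auto
    then have "C / 2 ^ n < e" using assms by (simp add: field_simps)
    then show ?thesis using that by blast
  qed
  ultimately show ?thesis by (meson order.strict_trans1)
qed

lemma continuous_map_log_modular: "continuous_map T euclideanreal log_modular"
  unfolding continuous_map_def
proof (intro conjI allI impI)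
  fix U :: "real set" assume "openin euclideanreal U"
  then have U: "open U" by simp
  show "openin T {x \<in> topspace T. log_modular x \<in> U}"
  proof (subst openin_subopen, intro ballI)
    fix x assume "x \<in> {x \<in> topspace T. log_modular x \<in> U}"
    then have x: "x \<in> carrier G" "log_modular x \<in> U" using topspace_eq_carrier by auto
    obtain e where e: "e > 0" "\<And>y. dist y (log_modular x) < e \<Longrightarrow> y \<in> U"
      using U x(2) by (auto simp: open_dist)
    obtain V where V: "openin T V" "\<one> \<in> V" "\<And>x. x \<in> V \<Longrightarrow> \<bar>log_modular x\<bar> < e"
      using log_modular_small_nhd[OF e(1)] by blast
    have VG: "V \<subseteq> carrier G" using openin_subset[OF V(1)] topspace_eq_carrier by simp
    have "x <# V \<subseteq> {x \<in> topspace T. log_modular x \<in> U}"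
    proof
      fix y assume "y \<in> x <# V"
      then obtain v where v: "v \<in> V" "y = x \<otimes> v" by (auto simp: l_coset_def)
      then show "y \<in> {x \<in> topspace T. log_modular x \<in> U}"
        using V(3)[OF v(1)] x VG log_modular_mult[of x v] topspace_eq_carrier
        by (auto intro!: e(2) simp: dist_real_def)
    qed
    moreover have "x \<in> x <# V" using V(2) x by (force simp: l_coset_def)
    ultimately show "\<exists>W. openin T W \<and> x \<in> W \<and> W \<subseteq> {x \<in> topspace T. log_modular x \<in> U}"
      using openin_l_coset[OF x(1) V(1)] by blast
  qed
qed simp

lemma measurable_log_modular: "log_modular \<in> borel_measurable M"
proof (rule borel_measurableI)
  fix S :: "real set" assume "open S"
  then have "openin T {x \<in> topspace T. log_modular x \<in> S}"
    using continuous_map_log_modular by (auto simp: continuous_map_def)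
  moreover have "log_modular -` S \<inter> space M = {x \<in> topspace T. log_modular x \<in> S}"
    using topspace_eq_carrier by auto
  ultimately show "log_modular -` S \<inter> space M \<in> sets M" using open_sets by simp
qed

end

section \<open>Invariance of the modular function under isomorphism\<close>

lemma left_haar_measure_iso:
  assumes G: "haar_group G T M" and H: "topological_group H S"
    and f: "f \<in> iso G H" "homeomorphic_map T S f"
    and N: "space N = topspace S" "sets N = sigma_sets (topspace S) {U. openin S U}"
  shows "f \<in> measurable M N" "left_haar_measure H S (distr M N f)"
proof -
  interpret G: haar_group G T M by fact
  interpret H: topological_group H S by fact
  interpret f: group_hom G H f
    using f(1) by unfold_locales (auto simp: iso_def)
  have cont: "continuous_map T S f" using f(2) homeomorphic_imp_continuous_map by blast
  show m: "f \<in> measurable M N"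
    using measurable_continuous_map[OF _ G.sets_M N cont] G.topspace_eq_carrier by simp
  have inj: "inj_on f (carrier G)" "f ` carrier G = carrier H"
    using f(1) by (auto simp: iso_def bij_betw_def)
  have em: "emeasure (distr M N f) A = emeasure M {x \<in> carrier G. f x \<in> A}" if "A \<in> sets N" for A
    using emeasure_distr[OF m that] by (simp add: vimage_def Int_def conj_commute)
  have "emeasure (distr M N f) K < \<infinity>" if K: "compactin S K" for K
  proof -
    obtain f' where f': "homeomorphic_maps T S f f'" using f(2) homeomorphic_map_maps by blast
    then have "compactin T (f' ` K)"
      using K image_compactin homeomorphic_maps_def by metis
    moreover have "{x \<in> carrier G. f x \<in> K} = f' ` K"
    proof (intro equalityI subsetI)
      fix x assume "x \<in> {x \<in> carrier G. f x \<in> K}"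
      then have "f x \<in> K" "x = f' (f x)"
        using f' G.topspace_eq_carrier by (auto simp: homeomorphic_maps_def)
      then show "x \<in> f' ` K" by blast
    next
      fix x assume "x \<in> f' ` K"
      then obtain y where y: "y \<in> K" "x = f' y" by blast
      then have "y \<in> topspace S" using compactin_subset_topspace[OF K] by blast
      then have "f (f' y) = y" "f' y \<in> topspace T"
        using f' by (auto simp: homeomorphic_maps_def continuous_map_def)
      then show "x \<in> {x \<in> carrier G. f x \<in> K}" using y G.topspace_eq_carrier by simp
    qed
    \<comment> \<open>\<open>H\<close> is assumed only to be a topological group, so measurability
      of \<open>K\<close> is not at hand; a set outside the sigma-algebra has
      \<open>emeasure\<close> 0 by default.\<close>
    moreover have "K \<in> sets N \<or> emeasure (distr M N f) K = 0"
      using emeasure_notin_sets[of K "distr M N f"] by auto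
    ultimately show ?thesis using em[of K] G.emeasure_compact_finite by auto
  qed
  moreover have "emeasure (distr M N f) (space (distr M N f)) \<noteq> 0"
  proof -
    have "{x \<in> carrier G. f x \<in> carrier H} = carrier G" by auto
    then show ?thesis
      using em[OF sets.top] N(1) H.topspace_eq_carrier G.emeasure_space_nonzero by simp
  qed
  moreover have "emeasure (distr M N f) (h <#\<^bsub>H\<^esub> A) = emeasure (distr M N f) A"
    if h: "h \<in> carrier H" and A: "A \<in> sets N" for h A
  proof -
    have AH: "A \<subseteq> carrier H" using sets.sets_into_space[OF A] N H.topspace_eq_carrier by simp
    obtain g where g: "g \<in> carrier G" "h = f g" using inj h by auto
    have hA: "h <#\<^bsub>H\<^esub> A = {x \<in> carrier H. inv\<^bsub>H\<^esub> h \<otimes>\<^bsub>H\<^esub> x \<in> A}"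
      using H.l_coset_eq_vimage[OF h AH] .
    have "continuous_map S S (\<lambda>x. inv\<^bsub>H\<^esub> h \<otimes>\<^bsub>H\<^esub> x)"
      using h by (intro H.continuous_map_l_mult) auto
    then have hm: "(\<lambda>x. inv\<^bsub>H\<^esub> h \<otimes>\<^bsub>H\<^esub> x) \<in> measurable N N"
      using measurable_continuous_map[OF N N] by blast
    have "h <#\<^bsub>H\<^esub> A \<in> sets N"
      using measurable_sets[OF hm A] hA N(1) H.topspace_eq_carrier
      by (simp add: vimage_def Int_def conj_commute)
    moreover have "{x \<in> carrier G. f x \<in> h <#\<^bsub>H\<^esub> A} = g <#\<^bsub>G\<^esub> {x \<in> carrier G. f x \<in> A}"
    proof -
      have "f (inv\<^bsub>G\<^esub> g \<otimes>\<^bsub>G\<^esub> x) = inv\<^bsub>H\<^esub> h \<otimes>\<^bsub>H\<^esub> f x" if "x \<in> carrier G" for x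
        using that g by simp
      moreover have "g <#\<^bsub>G\<^esub> {x \<in> carrier G. f x \<in> A}
          = {x \<in> carrier G. inv\<^bsub>G\<^esub> g \<otimes>\<^bsub>G\<^esub> x \<in> {x \<in> carrier G. f x \<in> A}}"
        by (rule G.l_coset_eq_vimage[OF g(1)]) simp
      ultimately show ?thesis using g hA by auto
    qed
    moreover have "{x \<in> carrier G. f x \<in> A} \<in> sets M"
      using measurable_sets[OF m A] by (simp add: vimage_def Int_def conj_commute)
    ultimately show ?thesis using em A G.emeasure_l_coset[OF g(1)] by simp
  qed
  ultimately show "left_haar_measure H S (distr M N f)"
    unfolding left_haar_measure_def using N by simp
qed

text \<open>The image of \<open>M\<close> is a Haar measure of \<open>H\<close>, hence
  \<open>c\<close> times \<open>N\<close>, and the constant cancels from the scaling identity. So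
  the modular function depends on the topological group and not on the chosen Haar measure.\<close>

lemma log_modular_iso:
  assumes G: "haar_group G T M" and H: "haar_group H S N"
    and f: "f \<in> iso G H" "homeomorphic_map T S f" and g: "g \<in> carrier G"
  shows "haar_group.log_modular H N (f g) = haar_group.log_modular G M g"
proof -
  interpret G: haar_group G T M by fact
  interpret H: haar_group H S N by fact
  interpret f: group_hom G H f
    using f(1) by unfold_locales (auto simp: iso_def)
  have N: "space N = topspace S" "sets N = sigma_sets (topspace S) {U. openin S U}"
    using H.topspace_eq_carrier H.sets_M by auto
  note h = left_haar_measure_iso[OF G H.topological_group_axioms f N]
  obtain c where c: "c > 0" "\<And>A. A \<in> sets N \<Longrightarrow> emeasure (distr M N f) A = ennreal c * emeasure N A"
    using H.haar_unique[OF h(2)] by auto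
  have em: "emeasure (distr M N f) A = emeasure M {x \<in> carrier G. f x \<in> A}" if "A \<in> sets N" for A
    using emeasure_distr[OF h(1) that] by (simp add: vimage_def Int_def conj_commute)
  show ?thesis
  proof (rule H.log_modular_eqI)
    fix A assume A: "A \<in> sets N"
    have s: "{x \<in> carrier G. f x \<in> A} \<in> sets M"
      using measurable_sets[OF h(1) A] by (simp add: vimage_def Int_def conj_commute)
    have "f (x \<otimes>\<^bsub>G\<^esub> inv\<^bsub>G\<^esub> g) = f x \<otimes>\<^bsub>H\<^esub> inv\<^bsub>H\<^esub> f g" if "x \<in> carrier G" for x
      using that g by simp
    moreover have "A #>\<^bsub>H\<^esub> f g = {y \<in> carrier H. y \<otimes>\<^bsub>H\<^esub> inv\<^bsub>H\<^esub> f g \<in> A}"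
      using H.r_coset_eq_vimage[OF f.hom_closed[OF g] H.sets_subset_carrier[OF A]] .
    moreover have "{x \<in> carrier G. f x \<in> A} #>\<^bsub>G\<^esub> g
        = {x \<in> carrier G. x \<otimes>\<^bsub>G\<^esub> inv\<^bsub>G\<^esub> g \<in> {x \<in> carrier G. f x \<in> A}}"
      by (rule G.r_coset_eq_vimage[OF g]) simp
    ultimately have "{x \<in> carrier G. f x \<in> A #>\<^bsub>H\<^esub> f g} = {x \<in> carrier G. f x \<in> A} #>\<^bsub>G\<^esub> g"
      using g by auto
    then have "ennreal c * emeasure N (A #>\<^bsub>H\<^esub> f g) = emeasure M ({x \<in> carrier G. f x \<in> A} #>\<^bsub>G\<^esub> g)"
      using c(2)[OF H.r_coset_sets[OF f.hom_closed[OF g] A]] em[OF H.r_coset_sets[OF f.hom_closed[OF g] A]] by simp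
    also have "\<dots> = ennreal (exp (G.log_modular g)) * (ennreal c * emeasure N A)"
      using G.emeasure_r_coset[OF g s] em[OF A] c(2)[OF A] by simp
    finally have "ennreal (1 / c) * (ennreal c * emeasure N (A #>\<^bsub>H\<^esub> f g))
        = ennreal (1 / c) * (ennreal c * (ennreal (exp (G.log_modular g)) * emeasure N A))"
      by (simp add: mult_ac)
    moreover have "ennreal (1 / c) * (ennreal c * x) = x" for x
      using c(1) by (simp add: mult.assoc[symmetric] ennreal_mult[symmetric])
    ultimately show "emeasure N (A #>\<^bsub>H\<^esub> f g) = ennreal (exp (G.log_modular g)) * emeasure N A"
      by simp
  qed
qed

subsection \<open>Strong ergodicity and the kernel of the modular function\<close>

lemma abs_cos_diff_le: "\<bar>cos a - cos b\<bar> \<le> \<bar>a - b\<bar>" for a b :: real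
proof -
  have "\<bar>cos a - cos b\<bar> = 2 * (\<bar>sin ((a + b) / 2)\<bar> * \<bar>sin ((b - a) / 2)\<bar>)"
    by (simp add: cos_diff_cos abs_mult)
  also have "\<dots> \<le> 2 * (1 * \<bar>(b - a) / 2\<bar>)"
    by (intro mult_left_mono mult_mono abs_sin_x_le_abs_x) auto
  finally show ?thesis by simp
qed

text \<open>The numbers \<open>c * t i\<close> modulo \<open>2 * pi\<close> give a point of a torus,
  which is cut into finitely many cells. \<open>F\<close> holds one frequency for each cell that is
  visited, so it does not depend on \<open>c\<close>; this uniformity later allows a group element
  to be chosen after \<open>F\<close>.\<close>

lemma finite_net_modulo_2pi:
  fixes t :: "nat \<Rightarrow> real"
  assumes "e > 0"
  shows "\<exists>F. finite F \<and> (\<forall>c. \<exists>f\<in>F. \<forall>i<n. \<exists>k::int. \<bar>(c - f) * t i - 2 * pi * k\<bar> \<le> e)"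
proof -
  obtain K :: nat where K: "2 * pi / e < K" using reals_Archimedean2 by blast
  have "0 < 2 * pi / e" using assms by simp
  then have K0: "0 < real K" using K by linarith
  \<comment> \<open>In a common cell the fractional parts differ by at most \<open>1 / K\<close> in
    each coordinate, an angle of at most \<open>2 * pi / K < e\<close>.\<close>
  define cell where "cell c = restrict (\<lambda>i. \<lfloor>K * frac (c * t i / (2 * pi))\<rfloor>) {..<n}" for c
  have "range cell \<subseteq> PiE {..<n} (\<lambda>_. {0..int K})"
  proof -
    have "0 \<le> \<lfloor>K * frac x\<rfloor>" "\<lfloor>K * frac x\<rfloor> \<le> int K" for x :: real
    proof -
      show "0 \<le> \<lfloor>K * frac x\<rfloor>" by simp
      have "real K * frac x \<le> real K * 1"
        by (intro mult_left_mono) (auto intro: less_imp_le frac_lt_1)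
      then show "\<lfloor>K * frac x\<rfloor> \<le> int K" by (simp add: floor_le_iff)
    qed
    then show ?thesis unfolding cell_def by (intro image_subsetI) (simp add: restrict_PiE_iff)
  qed
  then have fin: "finite (range cell)"
    by (rule finite_subset) (auto intro: finite_PiE)
  define r where "r v = (SOME c. cell c = v)" for v
  have r: "cell (r (cell c)) = cell c" for c unfolding r_def by (rule someI) simp
  have "\<exists>f\<in>r ` range cell. \<forall>i<n. \<exists>k::int. \<bar>(c - f) * t i - 2 * pi * k\<bar> \<le> e" for c
  proof (intro bexI[of _ "r (cell c)"] allI impI)
    fix i assume i: "i < n"
    define f where "f = r (cell c)"
    define x where "x = c * t i / (2 * pi)"
    define y where "y = f * t i / (2 * pi)"
    have "\<lfloor>K * frac x\<rfloor> = \<lfloor>K * frac y\<rfloor>"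
      using fun_cong[OF r[of c], of i] i by (simp add: cell_def x_def y_def f_def)
    then have "\<bar>K * frac x - K * frac y\<bar> \<le> 1" by linarith
    then have "K * \<bar>frac x - frac y\<bar> \<le> 1" by (simp add: abs_mult right_diff_distrib[symmetric])
    then have *: "\<bar>frac x - frac y\<bar> \<le> 1 / K" using K0 by (simp add: field_simps)
    have "(c - f) * t i - 2 * pi * of_int (\<lfloor>x\<rfloor> - \<lfloor>y\<rfloor>) = 2 * pi * (frac x - frac y)"
      by (simp add: frac_def x_def y_def field_simps)
    then have "\<bar>(c - f) * t i - 2 * pi * of_int (\<lfloor>x\<rfloor> - \<lfloor>y\<rfloor>)\<bar> = 2 * pi * \<bar>frac x - frac y\<bar>"
      by (simp add: abs_mult)
    also have "\<dots> \<le> 2 * pi * (1 / K)" using * by (intro mult_left_mono) auto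
    also have "\<dots> \<le> e" using K K0 assms by (simp add: field_simps)
    finally show "\<exists>k::int. \<bar>(c - r (cell c)) * t i - 2 * pi * k\<bar> \<le> e" unfolding f_def by blast
  qed auto
  then show ?thesis using fin by (intro exI[of _ "r ` range cell"]) auto
qed

text \<open>Otherwise there are sets of \<open>M\<close>-measure below \<open>(1/2) ^ n\<close> and
  \<open>N\<close>-measure at least \<open>e\<close>. By Borel-Cantelli their limit superior is
  \<open>M\<close>-null, while continuity from above gives it \<open>N\<close>-measure at least
  \<open>e\<close>.\<close>

lemma absolutely_continuous_eps_delta:
  assumes "finite_measure M" "finite_measure N" "sets N = sets M" "absolutely_continuous M N" "e > 0"
  shows "\<exists>d>0. \<forall>A\<in>sets M. measure M A < d \<longrightarrow> measure N A < e"
proof (rule ccontr)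
  interpret M: finite_measure M by fact
  interpret N: finite_measure N by fact
  assume "\<not> ?thesis"
  then have "\<forall>d>0. \<exists>A\<in>sets M. measure M A < d \<and> measure N A \<ge> e" by (meson not_le)
  then have "\<forall>n::nat. \<exists>A\<in>sets M. measure M A < (1/2) ^ n \<and> measure N A \<ge> e" by simp
  then obtain A where A: "\<And>n::nat. A n \<in> sets M" "\<And>n. measure M (A n) < (1/2) ^ n"
    "\<And>n. measure N (A n) \<ge> e" by metis
  have "limsup A \<in> null_sets M"
  proof (rule borel_cantelli_limsup1)
    show "summable (\<lambda>n. measure M (A n))"
      by (rule summable_comparison_test'[of "\<lambda>n. (1/2) ^ n" 0])
        (use A(2) in \<open>auto simp: less_imp_le\<close>)
  qed (use A in \<open>auto simp: less_top[symmetric]\<close>)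
  then have "limsup A \<in> null_sets N"
    using assms(4) by (auto simp: absolutely_continuous_def)
  moreover have "limsup A = (\<Inter>m. \<Union>n\<in>{m..}. A n)"
    by (simp add: limsup_INF_SUP)
  ultimately have z: "measure N (\<Inter>m. \<Union>n\<in>{m..}. A n) = 0"
    by (simp add: measure_def null_sets_def)
  have "(\<lambda>m. measure N (\<Union>n\<in>{m..}. A n)) \<longlonglongrightarrow> measure N (\<Inter>m. \<Union>n\<in>{m..}. A n)"
  proof (rule N.finite_Lim_measure_decseq)
    show "decseq (\<lambda>m. \<Union>n\<in>{m..}. A n)"
      unfolding decseq_def by (intro allI impI UN_mono) auto
  qed (use A(1) assms(3) in auto)
  moreover have "e \<le> measure N (\<Union>n\<in>{m..}. A n)" for m
    using A(1) assms(3) by (intro order_trans[OF A(3)[of m]] N.finite_measure_mono) auto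
  ultimately have "e \<le> 0"
    using z by (intro LIMSEQ_le_const) auto
  then show False using assms(5) by simp
qed

text \<open>Some of \<open>n + 1\<close> disjoint strips of equal width has measure at most \<open>1 / (n + 1)\<close>.\<close>

lemma (in prob_space) ex_strip_small_prob:
  assumes v: "v \<in> borel_measurable M"
  shows "\<exists>q::real. 1/4 \<le> q \<and> q < 1/2 \<and>
    prob {x \<in> space M. \<bar>v x - q\<bar> < 1 / (8 * real (Suc n))} \<le> 1 / real (Suc n)"
proof (rule ccontr)
  define h where "h = 1 / (8 * real (Suc n))"
  \<comment> \<open>\<open>h\<close> is such that \<open>n + 1\<close> strips of width
    \<open>2 * h\<close> fill the interval from 1/4 to 1/2. The upper end keeps the level below the
    1/2 of \<open>ex_phase_cos_prob_ge\<close>; the lower end will contradict a near change of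
    sign.\<close>
  define q where "q j = 1/4 + (2 * real j + 1) * h" for j
  define S where "S j = {x \<in> space M. \<bar>v x - q j\<bar> < h}" for j
  assume no: "\<not> ?thesis"
  have h: "h > 0" "h * (8 * real (Suc n)) = 1" by (auto simp: h_def)
  have big: "prob (S j) > 1 / real (Suc n)" if "j \<le> n" for j
  proof (rule ccontr)
    assume le: "\<not> ?thesis"
    have "(2 * real j + 1) * h \<le> (2 * real n + 1) * h"
      using that h by (intro mult_right_mono) auto
    moreover have "(2 * real n + 1) * h + h = 1/4" using h by (simp add: algebra_simps)
    ultimately have "q j < 1/2" using h(1) unfolding q_def by linarith
    have "1/4 \<le> q j" using h by (simp add: q_def)
    with \<open>q j < 1/2\<close> show False using no le unfolding S_def h_def by (auto simp: not_less)
  qed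
  have S: "S j \<in> events" for j unfolding S_def using v by measurable
  have disj: "disjoint_family_on S {..n}"
  proof (unfold disjoint_family_on_def, intro ballI impI)
    have *: "S i \<inter> S j = {}" if "i < j" for i j
    proof -
      have "(2 * real i + 2) * h \<le> (2 * real j) * h"
        using that h by (intro mult_right_mono) auto
      then have "q i + h \<le> q j - h" by (simp add: q_def algebra_simps)
      then show ?thesis by (auto simp: S_def)
    qed
    fix i j :: nat assume "i \<noteq> j"
    then show "S i \<inter> S j = {}" using *[of i j] *[of j i] by (cases "i < j") auto
  qed
  have "1 = (\<Sum>j\<le>n. 1 / real (Suc n))" by (simp add: field_simps)
  also have "\<dots> < (\<Sum>j\<le>n. prob (S j))" using big by (intro sum_strict_mono) auto
  also have "\<dots> = prob (\<Union>j\<le>n. S j)"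
    using S disj by (intro finite_measure_finite_Union[symmetric]) auto
  also have "\<dots> \<le> 1" by simp
  finally show False by simp
qed

text \<open>The four multiples of a quarter turn change the cosine into \<open>cos\<close>,
  \<open>- sin\<close>, \<open>- cos\<close> and \<open>sin\<close>. At each point one of these is
  at least 1/2, because the squares of sine and cosine add up to 1. So four sets cover the
  space.\<close>

lemma (in prob_space) ex_phase_cos_prob_ge:
  fixes u :: "'a \<Rightarrow> real"
  assumes u: "u \<in> borel_measurable M"
  shows "\<exists>\<theta>. prob {x \<in> space M. cos (u x + \<theta>) \<ge> 1/2} \<ge> 1/4"
proof (rule ccontr)
  assume no: "\<not> ?thesis"
  let ?S = "\<lambda>j::nat. {x \<in> space M. cos (u x + j * (pi / 2)) \<ge> 1/2}"
  have S: "?S j \<in> events" for j using u by measurable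
  have "space M \<subseteq> (\<Union>j<4. ?S j)"
  proof
    fix x assume x: "x \<in> space M"
    have "cos (u x + real 3 * (pi / 2)) = sin (u x)"
    proof -
      have "real 3 * (pi / 2) = pi + pi / 2" by simp
      then show ?thesis by (simp only: cos_add sin_add) simp
    qed
    then have *: "cos (u x + real 0 * (pi / 2)) = cos (u x)" "cos (u x + real 1 * (pi / 2)) = - sin (u x)"
       "cos (u x + real 2 * (pi / 2)) = - cos (u x)" "cos (u x + real 3 * (pi / 2)) = sin (u x)"
      by (simp_all add: cos_add)
    have "\<bar>cos (u x)\<bar> \<ge> 1/2 \<or> \<bar>sin (u x)\<bar> \<ge> 1/2"
    proof (rule ccontr)
      assume "\<not> ?thesis"
      then have "\<bar>cos (u x)\<bar> < 1/2" "\<bar>sin (u x)\<bar> < 1/2" by simp_all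
      then have "\<bar>cos (u x)\<bar>\<^sup>2 < (1/2)\<^sup>2" "\<bar>sin (u x)\<bar>\<^sup>2 < (1/2)\<^sup>2"
        by (intro power_strict_mono; simp)+
      then have "(sin (u x))\<^sup>2 + (cos (u x))\<^sup>2 < 1" by (simp add: power2_eq_square)
      then show False by simp
    qed
    then have "x \<in> ?S 0 \<or> x \<in> ?S 1 \<or> x \<in> ?S 2 \<or> x \<in> ?S 3"
      using x unfolding mem_Collect_eq * by auto
    moreover have sub: "x \<in> (\<Union>j<4. ?S j)" if "j < 4" "x \<in> ?S j" for j
      using that by (intro UN_I[of j]) simp_all
    ultimately show "x \<in> (\<Union>j<4. ?S j)" by (elim disjE) (erule sub[rotated], simp)+
  qed
  then have "1 \<le> prob (\<Union>j<4. ?S j)"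
    using S finite_measure_mono[of "space M" "\<Union>j<4. ?S j"] by (simp add: prob_space sets.finite_UN)
  also have "\<dots> \<le> (\<Sum>j<4. prob (?S j))"
    using S by (intro finite_measure_subadditive_finite) auto
  also have "\<dots> < (\<Sum>j<(4::nat). 1/4)"
    using no by (intro sum_strict_mono) (auto simp: not_le lessThan_empty_iff)
  finally show False by simp
qed

text \<open>At a point of the symmetric difference, the values of \<open>v n\<close> there and at
  the preimage under \<open>g\<close> lie on different sides of the level. Hence the point lies in
  the strip around the level, or \<open>v n\<close> jumps by at least \<open>h n\<close>. The strips
  vanish by hypothesis, the jumps by dominated convergence, as a related pair jumps only finitely
  often. Small variation alone would not do, since all mass could sit near the level.\<close>

lemma almost_invariant_superlevel_sets:
  fixes v :: "nat \<Rightarrow> 'a \<Rightarrow> real"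
  assumes "prob_space \<mu>"
    and v: "\<And>n. v n \<in> borel_measurable \<mu>"
    and inv: "\<And>x y. (x, y) \<in> R \<Longrightarrow> \<forall>\<^sub>F n in sequentially. \<bar>v n x - v n y\<bar> < h n"
    and strip: "(\<lambda>n. measure \<mu> {x \<in> space \<mu>. \<bar>v n x - q n\<bar> < h n}) \<longlonglongrightarrow> 0"
  shows "almost_invariant_sequence \<mu> R (\<lambda>n. {x \<in> space \<mu>. v n x > q n})"
  unfolding almost_invariant_sequence_def
proof (intro conjI allI ballI)
  interpret prob_space \<mu> by fact
  let ?A = "\<lambda>n. {x \<in> space \<mu>. v n x > q n}"
  let ?S = "\<lambda>n. {x \<in> space \<mu>. \<bar>v n x - q n\<bar> < h n}"
  show A: "?A n \<in> sets \<mu>" for n using v[of n] by measurable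
  have S: "?S n \<in> sets \<mu>" for n using v[of n] by measurable
  fix g assume "g \<in> full_group \<mu> R"
  then have g: "bij_betw g (space \<mu>) (space \<mu>)" "g \<in> measurable \<mu> \<mu>"
    "null_sets (distr \<mu> \<mu> g) = null_sets \<mu>" and gR: "AE x in \<mu>. (g x, x) \<in> R"
    and gi: "inv_into (space \<mu>) g \<in> measurable \<mu> \<mu>"
    by (auto simp: full_group_def nonsingular_iso_def)
  define g' where "g' = inv_into (space \<mu>) g"
  have g': "g' \<in> measurable \<mu> \<mu>" using gi by (simp add: g'_def)
  have g'g: "g' (g x) = x" if "x \<in> space \<mu>" for x
    using that g(1) by (simp add: g'_def bij_betw_def)
  have gg': "g (g' x) = x" "g' x \<in> space \<mu>" if "x \<in> space \<mu>" for x
    using that g(1) by (auto simp: g'_def bij_betw_def f_inv_into_f inv_into_into)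
  have vg': "(\<lambda>x. v n (g' x)) \<in> borel_measurable \<mu>" for n
    using measurable_compose[OF g' v] .
  define Z where "Z n = {x \<in> space \<mu>. \<bar>v n x - v n (g' x)\<bar> \<ge> h n}" for n
  have Z: "Z n \<in> sets \<mu>" for n unfolding Z_def using v[of n] vg'[of n] by measurable
  \<comment> \<open>The full group speaks of the pair at \<open>x\<close> and \<open>g x\<close>;
    here the image is the base point. The exceptional set is pulled back along \<open>g'\<close>,
    and nonsingularity of \<open>g\<close> keeps it null.\<close>
  have "AE x in \<mu>. (x, g' x) \<in> R"
  proof -
    obtain N where N: "N \<in> null_sets \<mu>" "{x \<in> space \<mu>. (g x, x) \<notin> R} \<subseteq> N"
      using gR by (auto simp: eventually_ae_filter)
    have N': "g' -` N \<inter> space \<mu> \<in> sets \<mu>" using measurable_sets[OF g', of N] N by auto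
    have "g -` (g' -` N \<inter> space \<mu>) \<inter> space \<mu> = N"
      using g'g sets.sets_into_space[of N \<mu>] N(1) measurable_space[OF g(2)] by auto
    then have "g' -` N \<inter> space \<mu> \<in> null_sets (distr \<mu> \<mu> g)"
      using N' N(1) null_sets_distr_iff[OF g(2)] by simp
    then have "g' -` N \<inter> space \<mu> \<in> null_sets \<mu>" using g(3) by simp
    moreover have "{x \<in> space \<mu>. (x, g' x) \<notin> R} \<subseteq> g' -` N \<inter> space \<mu>"
    proof
      fix x assume "x \<in> {x \<in> space \<mu>. (x, g' x) \<notin> R}"
      then have "x \<in> space \<mu>" "g' x \<in> {x \<in> space \<mu>. (g x, x) \<notin> R}" using gg' by auto
      then show "x \<in> g' -` N \<inter> space \<mu>" using N(2) by blast
    qed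
    ultimately show ?thesis by (rule AE_I')
  qed
  then have "AE x in \<mu>. (\<lambda>n. indicator (Z n) x :: real) \<longlonglongrightarrow> 0"
  proof (eventually_elim)
    fix x assume "(x, g' x) \<in> R"
    then have "\<forall>\<^sub>F n in sequentially. \<bar>v n x - v n (g' x)\<bar> < h n" by (rule inv)
    then have "\<forall>\<^sub>F n in sequentially. (indicator (Z n) x :: real) = 0"
      by eventually_elim (auto simp: Z_def)
    then show "(\<lambda>n. indicator (Z n) x :: real) \<longlonglongrightarrow> 0" by (rule tendsto_eventually)
  qed
  then have "(\<lambda>n. \<integral>x. indicator (Z n) x \<partial>\<mu>) \<longlonglongrightarrow> (\<integral>x. 0 \<partial>\<mu> :: real)"
    using Z by (intro integral_dominated_convergence[where w = "\<lambda>_. 1"]) auto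
  then have Z0: "(\<lambda>n. measure \<mu> (Z n)) \<longlonglongrightarrow> 0"
    using Z by simp
  have "measure \<mu> (sym_diff (?A n) (g ` ?A n)) \<le> measure \<mu> (?S n) + measure \<mu> (Z n)" for n
  proof -
    have "sym_diff (?A n) (g ` ?A n) \<subseteq> ?S n \<union> Z n"
    proof
      fix x assume x: "x \<in> sym_diff (?A n) (g ` ?A n)"
      have gA: "g ` ?A n = {x \<in> space \<mu>. v n (g' x) > q n}"
      proof (intro equalityI subsetI)
        fix x assume "x \<in> {x \<in> space \<mu>. v n (g' x) > q n}"
        then show "x \<in> g ` ?A n" using gg'[of x] by (intro image_eqI[of _ _ "g' x"]) auto
      qed (use g(1) g'g in \<open>auto simp: bij_betw_def\<close>)
      show "x \<in> ?S n \<union> Z n"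
        using x unfolding gA Z_def by auto
    qed
    then have "measure \<mu> (sym_diff (?A n) (g ` ?A n)) \<le> measure \<mu> (?S n \<union> Z n)"
      using S Z by (intro finite_measure_mono) auto
    also have "\<dots> \<le> measure \<mu> (?S n) + measure \<mu> (Z n)"
      using S Z by (intro measure_Un_le)
    finally show ?thesis .
  qed
  note le = this
  show "(\<lambda>n. measure \<mu> (sym_diff (?A n) (g ` ?A n))) \<longlonglongrightarrow> 0"
  proof (rule tendsto_sandwich[OF _ _ tendsto_const])
    show "(\<lambda>n. measure \<mu> (?S n) + measure \<mu> (Z n)) \<longlonglongrightarrow> 0"
      using tendsto_add[OF strip Z0] by (simp only: add_0)
    show "\<forall>\<^sub>F n in sequentially. 0 \<le> measure \<mu> (sym_diff (?A n) (g ` ?A n))"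
      by (rule always_eventually) simp
    show "\<forall>\<^sub>F n in sequentially.
        measure \<mu> (sym_diff (?A n) (g ` ?A n)) \<le> measure \<mu> (?S n) + measure \<mu> (Z n)"
      by (rule always_eventually) (use le in blast)
  qed
qed

section \<open>Almost invariant sets built from the modular function\<close>

context haar_group
begin

text \<open>If \<open>E\<close> never met its translate, every point of \<open>K\<close> would lie
  in \<open>B\<close>, the part of \<open>L\<close> missed by \<open>E\<close>, or in the translate
  of \<open>B\<close> by \<open>inv x\<close>. This bounds the measure of \<open>K\<close> by
  \<open>1 + exp C\<close> times that of \<open>B\<close>, which is small. One \<open>\<eta>\<close>
  must serve all \<open>x\<close> in \<open>U\<close>, because the translating element will vary
  along the sequence.\<close>

lemma ex_small_measure_translate_meets:
  assumes "prob_space \<mu>" "sets \<mu> = sets M" "null_sets \<mu> = null_sets M"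
  shows "\<exists>U \<eta>. openin T U \<and> \<one> \<in> U \<and> \<eta> > 0 \<and>
    (\<forall>x\<in>U. \<forall>E\<in>sets M. measure \<mu> (carrier G - E) < \<eta> \<longrightarrow> (\<exists>y\<in>E. y \<otimes> x \<in> E))"
proof -
  interpret mu: prob_space \<mu> by fact
  obtain U K where UK: "openin T U" "compactin T K" "\<one> \<in> U" "U \<subseteq> K" using ex_compact_nhd by blast
  obtain V C where V: "openin T V" "\<one> \<in> V" "\<And>x. x \<in> V \<Longrightarrow> \<bar>log_modular x\<bar> \<le> C"
    using log_modular_bounded_nhd by blast
  have KG: "K \<subseteq> carrier G" using compactin_subset_topspace[OF UK(2)] topspace_eq_carrier by simp
  define L where "L = (\<lambda>(x, y). x \<otimes> y) ` (K \<times> K)"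
  have "compactin (prod_topology T T) (K \<times> K)" using UK(2) by (simp add: compactin_Times)
  then have L: "compactin T L" using image_compactin continuous_mult unfolding L_def by blast
  have Ls: "L \<in> sets M" using compact_sets[OF L] .
  have KL: "K \<subseteq> L"
  proof
    fix x assume "x \<in> K"
    then have "x = x \<otimes> \<one>" "(x, \<one>) \<in> K \<times> K" using KG UK by auto
    then show "x \<in> L" unfolding L_def by (metis (no_types, lifting) case_prod_conv image_eqI)
  qed
  \<comment> \<open>\<open>M\<close> may be infinite, and the epsilon-delta form of absolute
    continuity needs a finite measure, so \<open>M\<close> is cut down to the compact
    \<open>L\<close>.\<close>
  define N where "N = density M (indicator L)"
  have N: "emeasure N A = emeasure M (L \<inter> A)" if "A \<in> sets M" for A
    using that Ls by (simp add: N_def emeasure_density indicator_inter_arith[symmetric] nn_integral_indicator mult.commute Int_commute)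
  have "emeasure N (space N) \<noteq> \<infinity>"
    using N[OF sets.top] emeasure_compact_finite[OF L] sets_subset_carrier[OF Ls]
    by (simp add: N_def Int_absorb2)
  then interpret N: finite_measure N by (rule finite_measureI)
  have "absolutely_continuous \<mu> N"
    unfolding absolutely_continuous_def assms(3)
    using absolutely_continuousI_density[of "indicator L" M] Ls
    by (auto simp: absolutely_continuous_def N_def)
  define k where "k = measure M K"
  have "0 < emeasure M U" using UK emeasure_open_pos by blast
  also have "\<dots> \<le> emeasure M K" using UK compact_sets by (intro emeasure_mono) auto
  finally have k: "emeasure M K = ennreal k" "k > 0"
    using emeasure_compact_finite[OF UK(2)]
    by (auto simp: k_def measure_def ennreal_enn2real_if enn2real_positive_iff less_top)
  \<comment> \<open>Chosen with \<open>(1 + exp C) * e = k\<close>, so that the covering below would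
    give \<open>K\<close> measure less than \<open>k\<close>.\<close>
  define e where "e = k / (1 + exp C)"
  have expC: "1 + exp C > 0" by (simp add: add_pos_pos)
  have e: "e > 0" unfolding e_def by (intro divide_pos_pos k(2) expC)
  obtain \<eta> where \<eta>: "\<eta> > 0" "\<And>A. A \<in> sets M \<Longrightarrow> measure \<mu> A < \<eta> \<Longrightarrow> measure N A < e"
    using absolutely_continuous_eps_delta[of \<mu> N e] mu.finite_measure_axioms N.finite_measure_axioms
      \<open>absolutely_continuous \<mu> N\<close> e assms(2) by (auto simp: N_def)
  have "\<exists>y\<in>E. y \<otimes> x \<in> E"
    if x: "x \<in> U \<inter> V" and E: "E \<in> sets M" and small: "measure \<mu> (carrier G - E) < \<eta>" for x E
  proof (rule ccontr)
    assume no: "\<not> ?thesis"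
    have xG: "x \<in> carrier G" "x \<in> K" using x UK KG by auto
    define B where "B = L \<inter> (carrier G - E)"
    have cE: "carrier G - E \<in> sets M" using E sets.Diff[OF sets.top E] by simp
    have B: "B \<in> sets M" using cE Ls by (simp add: B_def)
    have "ennreal (measure N (carrier G - E)) < ennreal e"
      by (rule ennreal_lessI[OF e \<eta>(2)[OF cE small]])
    then have Be: "emeasure M B < ennreal e"
      using N[OF cE] by (simp add: B_def N.emeasure_eq_measure)
    have "K \<subseteq> B \<union> (B #> inv x)"
    proof
      fix y assume y: "y \<in> K"
      then have yG: "y \<in> carrier G" "y \<in> L" "y \<otimes> x \<in> L" using KG KL xG(2) by (auto simp: L_def)
      show "y \<in> B \<union> (B #> inv x)"
      proof (cases "y \<in> E")
        case True
        then have "y \<otimes> x \<in> B" using no yG xG by (auto simp: B_def)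
        then have "(y \<otimes> x) \<otimes> inv x \<in> B #> inv x" by (auto simp: r_coset_def)
        then show ?thesis using yG xG by (simp add: m_assoc)
      qed (use yG in \<open>simp add: B_def\<close>)
    qed
    then have "emeasure M K \<le> emeasure M (B \<union> (B #> inv x))"
      using B r_coset_sets[of "inv x" B] xG by (intro emeasure_mono) auto
    also have "\<dots> \<le> emeasure M B + emeasure M (B #> inv x)"
      using B r_coset_sets[of "inv x" B] xG by (intro emeasure_subadditive) auto
    also have "\<dots> = emeasure M B + ennreal (exp (- log_modular x)) * emeasure M B"
      using emeasure_r_coset[of "inv x" B] B xG by (simp add: log_modular_inv)
    also have "\<dots> \<le> emeasure M B + ennreal (exp C) * emeasure M B"
      using V(3)[of x] x by (intro add_left_mono mult_right_mono ennreal_leI) auto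
    also have "\<dots> = ennreal (1 + exp C) * emeasure M B"
      by (simp add: ennreal_plus distrib_right)
    also have "\<dots> < ennreal (1 + exp C) * ennreal e"
      by (rule ennreal_mult_strict_left_mono[OF Be])
        (use expC in \<open>simp_all del: ennreal_plus\<close>)
    also have "\<dots> = ennreal k"
      using e expC by (simp add: ennreal_mult[symmetric] e_def del: ennreal_plus)
    finally show False using k by simp
  qed
  then show ?thesis
    using UK V \<eta>(1) by (intro exI[of _ "U \<inter> V"] exI[of _ \<eta>]) auto
qed

text \<open>The frequency \<open>pi / log_modular x\<close> shifts the angle by exactly
  \<open>pi\<close>; subtracting a suitable \<open>f\<close> of the net brings its products with all
  \<open>t i\<close> close to multiples of \<open>2 * pi\<close>. The net and its bound
  \<open>B\<close> come before \<open>x\<close>, so \<open>\<bar>log_modular x\<bar>\<close> can be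
  kept below \<open>1 / (4 * B)\<close>, and the subtraction costs at most 1/4.\<close>

lemma ex_frequency_reversing:
  fixes t :: "nat \<Rightarrow> real" and n :: nat
  assumes nontriv: "\<And>V. openin T V \<Longrightarrow> \<one> \<in> V \<Longrightarrow> \<exists>x\<in>V. log_modular x \<noteq> 0"
    and U: "openin T U" "\<one> \<in> U" and e: "e > 0"
  shows "\<exists>w. \<exists>x\<in>U. \<bar>w * log_modular x - pi\<bar> \<le> 1/4 \<and> (\<forall>i<n. \<exists>k::int. \<bar>w * t i - 2 * pi * k\<bar> \<le> e)"
proof -
  obtain F where F: "finite F" "\<And>c. \<exists>f\<in>F. \<forall>i<n. \<exists>k::int. \<bar>(c - f) * t i - 2 * pi * k\<bar> \<le> e"
    using finite_net_modulo_2pi[OF e, of n t] by blast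
  obtain B where B: "\<And>f. f \<in> F \<Longrightarrow> \<bar>f\<bar> \<le> B" "B > 0"
  proof
    show "\<bar>f\<bar> \<le> (\<Sum>f\<in>F. \<bar>f\<bar>) + 1" if "f \<in> F" for f
      using member_le_sum[OF that, of abs] F(1) by simp
    have "0 \<le> (\<Sum>f\<in>F. \<bar>f\<bar>)" by (rule sum_nonneg) simp
    then show "0 < (\<Sum>f\<in>F. \<bar>f\<bar>) + 1" by linarith
  qed
  have B4: "1 / (4 * B) > 0" using B(2) by simp
  then obtain V where V: "openin T V" "\<one> \<in> V" "\<And>x. x \<in> V \<Longrightarrow> \<bar>log_modular x\<bar> < 1 / (4 * B)"
    using log_modular_small_nhd[OF B4] by blast
  have "openin T (U \<inter> V)" "\<one> \<in> U \<inter> V" using U V by auto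
  then obtain x where x: "x \<in> U" "x \<in> V" "log_modular x \<noteq> 0" using nontriv by blast
  obtain f where f: "f \<in> F" "\<forall>i<n. \<exists>k::int. \<bar>(pi / log_modular x - f) * t i - 2 * pi * k\<bar> \<le> e"
    using F(2) by blast
  have "(pi / log_modular x - f) * log_modular x - pi = - (f * log_modular x)"
    using x(3) by (simp add: left_diff_distrib)
  moreover have "\<bar>f * log_modular x\<bar> \<le> B * (1 / (4 * B))"
    unfolding abs_mult using B(1)[OF f(1)] V(3)[OF x(2)] B(2) by (intro mult_mono) auto
  ultimately have "\<bar>(pi / log_modular x - f) * log_modular x - pi\<bar> \<le> 1/4" using B(2) by simp
  then show ?thesis using x(1) f(2) by blast
qed

text \<open>
  If the kernel of the modular function were not open, one could find frequencies \<open>w\<close> such that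
  \<open>exp (\<i> w \<delta>)\<close>, with \<open>\<delta>\<close> the logarithm of the modular function, is almost invariant under left
  translation by more and more elements of \<open>\<Gamma>\<close>, but changes its sign under right translation by
  some element close to \<open>\<one>\<close>. The latter prevents the superlevel sets from being nearly null or conull.
\<close>

lemma strongly_ergodic_imp_log_modular_locally_zero:
  assumes mu: "prob_space \<mu>" "sets \<mu> = sets M" "null_sets \<mu> = null_sets M"
    and \<Gamma>: "subgroup \<Gamma> G" "countable \<Gamma>"
    and se: "strongly_ergodic \<mu> (orbit_relation (G\<lparr>carrier := \<Gamma>\<rparr>) (left_translation G) \<mu>)"
  shows "\<exists>V. openin T V \<and> \<one> \<in> V \<and> (\<forall>x\<in>V. log_modular x = 0)"
proof (rule ccontr)
  interpret prob_space \<mu> by fact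
  interpret \<Gamma>: subgroup \<Gamma> G by fact
  assume "\<not> ?thesis"
  then have nontriv: "\<And>V. openin T V \<Longrightarrow> \<one> \<in> V \<Longrightarrow> \<exists>x\<in>V. log_modular x \<noteq> 0" by blast
  have sp: "space \<mu> = carrier G" using sets_eq_imp_space_eq[OF mu(2)] by simp
  have lm: "log_modular \<in> borel_measurable \<mu>"
    using measurable_log_modular measurable_cong_sets[OF mu(2) refl] by blast
  obtain U \<eta> where U: "openin T U" "\<one> \<in> U" "\<eta> > 0"
    "\<And>x E. x \<in> U \<Longrightarrow> E \<in> sets M \<Longrightarrow> measure \<mu> (carrier G - E) < \<eta> \<Longrightarrow> \<exists>y\<in>E. y \<otimes> x \<in> E"
    using ex_small_measure_translate_meets[OF mu] by blast
  define \<gamma> where "\<gamma> = from_nat_into \<Gamma>"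
  have \<gamma>: "range \<gamma> = \<Gamma>" 
    unfolding \<gamma>_def using \<Gamma>(2) subgroup.one_closed[OF \<Gamma>(1)]
    by (intro range_from_nat_into) (metis empty_iff, assumption)
  \<comment> \<open>This is the half-width of the strips in \<open>ex_strip_small_prob\<close>. The
    frequencies below achieve half of it, so that \<open>v n\<close> moves by strictly less than
    \<open>h n\<close>.\<close>
  define h where "h n = 1 / (8 * real (Suc n))" for n
  have h: "h n > 0" for n by (simp add: h_def)
  have "\<exists>w. \<exists>x\<in>U. \<bar>w * log_modular x - pi\<bar> \<le> 1/4 \<and>
      (\<forall>i<n. \<exists>k::int. \<bar>w * log_modular (\<gamma> i) - 2 * pi * k\<bar> \<le> h n / 2)" for n
    using h[of n] by (intro ex_frequency_reversing[OF nontriv U(1,2)]) auto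
  then obtain w x where x: "\<And>n. x n \<in> U" "\<And>n. \<bar>w n * log_modular (x n) - pi\<bar> \<le> 1/4"
    and w: "\<And>n i. i < n \<Longrightarrow> \<exists>k::int. \<bar>w n * log_modular (\<gamma> i) - 2 * pi * k\<bar> \<le> h n / 2"
    by metis
  have "\<exists>\<theta>. prob {y \<in> space \<mu>. cos (w n * log_modular y + \<theta>) \<ge> 1/2} \<ge> 1/4" for n
    using lm by (intro ex_phase_cos_prob_ge) auto
  then obtain \<theta> where \<theta>: "\<And>n. prob {y \<in> space \<mu>. cos (w n * log_modular y + \<theta> n) \<ge> 1/2} \<ge> 1/4"
    by metis
  define v where "v n y = cos (w n * log_modular y + \<theta> n)" for n y
  have v: "v n \<in> borel_measurable \<mu>" for n unfolding v_def using lm by measurable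
  define thin where "thin n q \<longleftrightarrow> prob {y \<in> space \<mu>. \<bar>v n y - q\<bar> < h n} \<le> 1 / real (Suc n)" for n q
  have "\<exists>q. 1/4 \<le> q \<and> q < 1/2 \<and> thin n q" for n
    using ex_strip_small_prob[OF v[of n], of n] unfolding h_def thin_def .
  then obtain q where q: "\<And>n. 1/4 \<le> q n" "\<And>n. q n < 1/2" "\<And>n. thin n (q n)"
    by metis
  let ?R = "orbit_relation (G\<lparr>carrier := \<Gamma>\<rparr>) (left_translation G) \<mu>"
  let ?A = "\<lambda>n. {y \<in> space \<mu>. v n y > q n}"
  have A: "?A n \<in> sets \<mu>" for n using v[of n] by measurable
  have "almost_invariant_sequence \<mu> ?R ?A"
  proof (rule almost_invariant_superlevel_sets[OF mu(1) v])
    fix z y assume "(z, y) \<in> ?R"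
    then obtain g where g: "g \<in> \<Gamma>" "y \<in> carrier G" "z = g \<otimes> y"
      by (auto simp: orbit_relation_def orbit_def left_translation_def sp)
    then obtain i where i: "g = \<gamma> i" using \<gamma> by blast
    have "\<bar>v n z - v n y\<bar> < h n" if n: "n > i" for n
    proof -
      obtain k :: int where k: "\<bar>w n * log_modular g - 2 * pi * k\<bar> \<le> h n / 2"
        using w[OF n] i by blast
      \<comment> \<open>Inserting \<open>k\<close> full turns leaves the cosine unchanged, so the
        Lipschitz bound sees only the distance of \<open>w n * log_modular g\<close> from
        \<open>2 * pi * k\<close>.\<close>
      have "v n y = cos (w n * log_modular y + \<theta> n + 2 * pi * of_int k)"
        unfolding v_def by (simp add: cos_add)
      moreover have "v n z = cos (w n * log_modular g + w n * log_modular y + \<theta> n)"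
        unfolding v_def g(3) using g by (simp add: log_modular_mult distrib_left)
      ultimately have "\<bar>v n z - v n y\<bar> \<le> \<bar>w n * log_modular g - 2 * pi * k\<bar>"
        using abs_cos_diff_le[of "w n * log_modular g + w n * log_modular y + \<theta> n"
            "w n * log_modular y + \<theta> n + 2 * pi * of_int k"] by simp
      also have "\<dots> < h n" using k h[of n] by linarith
      finally show ?thesis .
    qed
    then show "\<forall>\<^sub>F n in sequentially. \<bar>v n z - v n y\<bar> < h n"
      unfolding eventually_at_top_dense by blast
  next
    show "(\<lambda>n. prob {y \<in> space \<mu>. \<bar>v n y - q n\<bar> < h n}) \<longlonglongrightarrow> 0"
    proof (rule tendsto_sandwich[OF _ _ tendsto_const])
      show "(\<lambda>n. 1 / real (Suc n)) \<longlonglongrightarrow> 0" by (rule LIMSEQ_Suc[OF lim_1_over_n])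
    qed (use q(3) in \<open>auto simp: thin_def\<close>)
  qed
  then have lim: "(\<lambda>n. prob (?A n) * (1 - prob (?A n))) \<longlonglongrightarrow> 0"
    using se by (auto simp: strongly_ergodic_def)
  have lower: "1/4 \<le> prob (?A n)" for n
  proof -
    have "prob {y \<in> space \<mu>. v n y \<ge> 1/2} \<le> prob (?A n)"
      using q(2)[of n] A by (intro finite_measure_mono) auto
    then show ?thesis using \<theta>[of n] unfolding v_def by linarith
  qed
  \<comment> \<open>A nearly conull \<open>?A n\<close> would contain some \<open>y\<close> together
    with \<open>y \<otimes> x n\<close>. Right translation by \<open>x n\<close> shifts the angle by
    nearly \<open>pi\<close>, so the two values of \<open>v n\<close> add up to at most 1/4, yet
    each exceeds \<open>q n \<ge> 1/4\<close>.\<close>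
  have upper: "\<eta> \<le> 1 - prob (?A n)" for n
  proof (rule ccontr)
    assume "\<not> ?thesis"
    then have "prob (carrier G - ?A n) < \<eta>"
      using prob_compl[OF A[of n]] sp by simp
    then obtain y where y: "y \<in> ?A n" "y \<otimes> x n \<in> ?A n"
      using U(4)[OF x(1)[of n], of "?A n"] A[of n] mu(2) by blast
    have G: "y \<in> carrier G" "x n \<in> carrier G"
      using y sp openin_subset[OF U(1)] x(1)[of n] topspace_eq_carrier by auto
    have "v n (y \<otimes> x n) = cos (w n * log_modular y + w n * log_modular (x n) + \<theta> n)"
      unfolding v_def using G by (simp add: log_modular_mult distrib_left)
    moreover have "v n y = - cos (w n * log_modular y + \<theta> n + pi)"
      unfolding v_def by simp
    ultimately have "\<bar>v n (y \<otimes> x n) + v n y\<bar> \<le> \<bar>w n * log_modular (x n) - pi\<bar>"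
      using abs_cos_diff_le[of "w n * log_modular y + w n * log_modular (x n) + \<theta> n"
          "w n * log_modular y + \<theta> n + pi"] by simp
    then show False using x(2)[of n] y q(1)[of n] by auto
  qed
  have "1/4 * \<eta> \<le> prob (?A n) * (1 - prob (?A n))" for n
    using lower[of n] upper[of n] U(3) by (intro mult_mono) auto
  then have "1/4 * \<eta> \<le> 0"
    using lim by (intro LIMSEQ_le_const) auto
  then show False using U(3) by simp
qed

end

subsection \<open>Open subgroups and orbit equivalence\<close>

lemma lcsc_group_iso:
  assumes G: "lcsc_group G T" and H: "group H" and f: "f \<in> iso G H" "homeomorphic_map T S f"
    and S: "topspace S = carrier H"
  shows "lcsc_group H S"
proof -
  interpret G: lcsc_group G T by fact
  interpret H: group H by fact
  interpret f: group_hom G H f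
    using f(1) by unfold_locales (auto simp: iso_def)
  obtain f' where f': "homeomorphic_maps T S f f'" using f(2) homeomorphic_map_maps by blast
  have c: "continuous_map T S f" "continuous_map S T f'"
    using f' by (auto simp: homeomorphic_maps_def)
  have inv: "f (f' y) = y" "f' y \<in> carrier G" if "y \<in> carrier H" for y
    using f' that S G.topspace_eq_carrier by (auto simp: homeomorphic_maps_def continuous_map_def)
  have hs: "T homeomorphic_space S" using homeomorphic_map_imp_homeomorphic_space f(2) by blast
  show ?thesis
  proof unfold_locales
    have "continuous_map (prod_topology S S) T (\<lambda>z. f' (fst z) \<otimes>\<^bsub>G\<^esub> f' (snd z))"
      by (intro G.continuous_map_group_mult continuous_map_compose[OF continuous_map_fst c(2), unfolded o_def]
          continuous_map_compose[OF continuous_map_snd c(2), unfolded o_def])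
    then have "continuous_map (prod_topology S S) S (\<lambda>z. f (f' (fst z) \<otimes>\<^bsub>G\<^esub> f' (snd z)))"
      using continuous_map_compose[OF _ c(1)] by (auto simp: o_def)
    then show "continuous_map (prod_topology S S) S (\<lambda>(x, y). x \<otimes>\<^bsub>H\<^esub> y)"
      by (rule continuous_map_eq) (auto simp: S inv)
    have "continuous_map S T (\<lambda>y. inv\<^bsub>G\<^esub> f' y)"
      by (rule G.continuous_map_group_inv[OF c(2)])
    then have "continuous_map S S (\<lambda>y. f (inv\<^bsub>G\<^esub> f' y))"
      using continuous_map_compose[OF _ c(1)] by (auto simp: o_def)
    then show "continuous_map S S (\<lambda>x. inv\<^bsub>H\<^esub> x)"
      by (rule continuous_map_eq) (auto simp: S inv)
    show "Hausdorff_space S" using homeomorphic_Hausdorff_space[OF hs] G.Hausdorff by simp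
    show "locally_compact_space S" using homeomorphic_locally_compact_space[OF hs] G.locally_compact by simp
    show "second_countable S" using homeomorphic_space_second_countability[OF hs] G.second_countable_top by simp
  qed (fact S)
qed

text \<open>This puts a copy of \<open>T\<close> on the image of an arbitrary injection. When the
  image is a set of reals, the copy need not be related to their usual topology.\<close>

lemma homeomorphic_map_pullback_topology:
  assumes "inj_on f (topspace T)"
  shows "homeomorphic_map T (pullback_topology (f ` topspace T) (inv_into (topspace T) f) T) f"
proof -
  let ?S = "pullback_topology (f ` topspace T) (inv_into (topspace T) f) T"
  have ts: "topspace ?S = f ` topspace T"
    using assms by (auto simp: topspace_pullback_topology)
  have "continuous_map T ?S f"
    unfolding continuous_map_def
  proof (intro conjI allI impI)
    show "f \<in> topspace T \<rightarrow> topspace ?S" using ts by auto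
    fix W assume "openin ?S W"
    then obtain U where U: "openin T U" "W = inv_into (topspace T) f -` U \<inter> f ` topspace T"
      by (auto simp: openin_pullback_topology)
    then have "{x \<in> topspace T. f x \<in> W} = U"
      using assms openin_subset[OF U(1)] by (auto dest: inj_onD)
    then show "openin T {x \<in> topspace T. f x \<in> W}" using U by simp
  qed
  moreover have "continuous_map ?S T (inv_into (topspace T) f)"
    unfolding continuous_map_def
  proof (intro conjI allI impI)
    show "inv_into (topspace T) f \<in> topspace ?S \<rightarrow> topspace T"
      using ts assms by auto
    fix U assume "openin T U"
    moreover have "{x \<in> topspace ?S. inv_into (topspace T) f x \<in> U} = inv_into (topspace T) f -` U \<inter> f ` topspace T"
      using ts by auto
    ultimately show "openin ?S {x \<in> topspace ?S. inv_into (topspace T) f x \<in> U}"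
      by (auto simp: openin_pullback_topology)
  qed
  ultimately have "homeomorphic_maps T ?S f (inv_into (topspace T) f)"
    using ts assms by (auto simp: homeomorphic_maps_def)
  then show ?thesis using homeomorphic_map_maps by blast
qed

text \<open>In a Hausdorff space with a countable base, a point is determined by the indices of the
  basic sets that contain it, and sets of naturals inject into the reals.\<close>

lemma (in lcsc_group) ex_inj_real: "\<exists>e :: 'a \<Rightarrow> real. inj_on e (carrier G)"
proof -
  obtain \<B> where \<B>: "countable \<B>" "\<And>V. V \<in> \<B> \<Longrightarrow> openin T V"
    "\<And>U x. openin T U \<Longrightarrow> x \<in> U \<Longrightarrow> \<exists>V\<in>\<B>. x \<in> V \<and> V \<subseteq> U"
    using second_countable_top unfolding second_countable_def by meson
  obtain r :: "nat set \<Rightarrow> real" where r: "inj r"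
    using nat_sets_lepoll_reals01 unfolding lepoll_def by blast
  let ?c = "\<lambda>x. {n. \<exists>V\<in>\<B>. x \<in> V \<and> n = to_nat_on \<B> V}"
  have "inj_on ?c (carrier G)"
  proof (rule inj_onI, rule ccontr)
    fix x y assume xy: "x \<in> carrier G" "y \<in> carrier G" "?c x = ?c y" "x \<noteq> y"
    then obtain U W where "openin T U" "x \<in> U" "y \<in> W" "disjnt U W"
      using Hausdorff[unfolded Hausdorff_space_def, rule_format, of x y] topspace_eq_carrier by auto
    then have U: "openin T U" "x \<in> U" "y \<notin> U" by (auto simp: disjnt_iff)
    then obtain V where V: "V \<in> \<B>" "x \<in> V" "V \<subseteq> U" using \<B>(3) by blast
    then have "to_nat_on \<B> V \<in> ?c y" using xy(3) by blast
    then obtain V' where "V' \<in> \<B>" "y \<in> V'" "to_nat_on \<B> V = to_nat_on \<B> V'" by blast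
    then have "V = V'" using \<B>(1) V(1) by (simp add: to_nat_on_inj)
    then show False using V U \<open>y \<in> V'\<close> by blast
  qed
  then have "inj_on (r \<circ> ?c) (carrier G)"
    using r by (intro comp_inj_on) (auto intro: inj_on_subset)
  then show ?thesis by blast
qed

section \<open>Translation actions and open subgroups\<close>

lemma (in lcsc_group) nonsingular_action_left_translation:
  assumes mu: "haar_probability G T \<mu>" and \<Gamma>: "subgroup \<Gamma> G" "countable \<Gamma>"
  shows "nonsingular_action (G\<lparr>carrier := \<Gamma>\<rparr>) (left_translation G) \<mu>"
proof -
  obtain M where M: "left_haar_measure G T M" "sets \<mu> = sets M" "null_sets \<mu> = null_sets M"
    using mu by (auto simp: haar_probability_def)
  interpret haar_group G T M by unfold_locales fact
  interpret \<Gamma>: subgroup \<Gamma> G by fact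
  have sp: "space \<mu> = carrier G" using sets_eq_imp_space_eq[OF M(2)] by simp
  have bij: "bij_betw (left_translation G g) (carrier G) (carrier G)" if "g \<in> carrier G" for g
    using that by (intro bij_betw_byWitness[where f' = "left_translation G (inv g)"])
      (auto simp: left_translation_def m_assoc[symmetric])
  have "group_hom (G\<lparr>carrier := \<Gamma>\<rparr>) (BijGroup (space \<mu>)) (left_translation G)"
  proof (intro group_hom.intro group_hom_axioms.intro)
    show "group (G\<lparr>carrier := \<Gamma>\<rparr>)" using subgroup_imp_group[OF \<Gamma>(1)] .
    show "group (BijGroup (space \<mu>))" by (rule group_BijGroup)
    show "left_translation G \<in> hom (G\<lparr>carrier := \<Gamma>\<rparr>) (BijGroup (space \<mu>))"
      unfolding hom_def BijGroup_def Bij_def sp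
      using bij by (auto simp: left_translation_def compose_def fun_eq_iff m_assoc)
  qed
  moreover have "nonsingular_iso \<mu> \<mu> (left_translation G g)" if g: "g \<in> \<Gamma>" for g
  proof -
    have gG: "g \<in> carrier G" using g by auto
    have meas: "left_translation G h \<in> measurable \<mu> \<mu>" if "h \<in> carrier G" for h
    proof -
      have "(\<lambda>x. h \<otimes> x) \<in> measurable \<mu> \<mu>"
        using measurable_l_mult[OF that] measurable_cong_sets[OF M(2) M(2)] by blast
      then show ?thesis
        by (subst measurable_cong[where g = "\<lambda>x. h \<otimes> x"]) (auto simp: left_translation_def sp)
    qed
    have "inv_into (space \<mu>) (left_translation G g) x = left_translation G (inv g) x" if "x \<in> space \<mu>" for x
    proof (rule inv_into_f_eq)
      show "inj_on (left_translation G g) (space \<mu>)" using bij[OF gG] by (simp add: bij_betw_def sp)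
    qed (use that gG sp in \<open>auto simp: left_translation_def m_assoc[symmetric]\<close>)
    then have "inv_into (space \<mu>) (left_translation G g) \<in> measurable \<mu> \<mu>"
      using meas[of "inv g"] gG by (subst measurable_cong) auto
    moreover have "null_sets (distr \<mu> \<mu> (left_translation G g)) = null_sets \<mu>"
    proof -
      have "A \<in> null_sets (distr \<mu> \<mu> (left_translation G g)) \<longleftrightarrow> A \<in> null_sets M" if A: "A \<in> sets M" for A
      proof -
        have "left_translation G g -` A \<inter> space \<mu> = {x \<in> carrier G. g \<otimes> x \<in> A}"
          by (auto simp: left_translation_def sp)
        then have "A \<in> null_sets (distr \<mu> \<mu> (left_translation G g))
            \<longleftrightarrow> {x \<in> carrier G. g \<otimes> x \<in> A} \<in> null_sets \<mu>"
          using null_sets_distr_iff[OF meas[OF gG]] A M(2) by simp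
        also have "\<dots> \<longleftrightarrow> A \<in> null_sets M"
          using emeasure_l_vimage[OF gG A] A vimage_sets[OF measurable_l_mult[OF gG] A]
          unfolding M(3) by (simp add: null_sets_def)
        finally show ?thesis .
      qed
      then show ?thesis using M by (auto simp: null_sets_def)
    qed
    ultimately show ?thesis
      using bij[OF gG] meas[OF gG] by (simp add: nonsingular_iso_def sp)
  qed
  ultimately show ?thesis
    using \<Gamma>(2) by (simp add: nonsingular_action_def group_action_def)
qed

text \<open>Openness gives \<open>L\<close> local compactness and positive measure, so the
  restricted measure is non-zero and again a Haar measure.\<close>

lemma (in haar_group) haar_group_open_subgroup:
  assumes L: "subgroup L G" "openin T L"
  shows "haar_group (G\<lparr>carrier := L\<rparr>) (subtopology T L) (restrict_space M L)"
proof -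
  interpret L: subgroup L G by fact
  let ?G = "G\<lparr>carrier := L\<rparr>" and ?T = "subtopology T L" and ?M = "restrict_space M L"
  have LG: "L \<subseteq> carrier G" by (rule L.subset)
  have Ls: "L \<in> sets M" using open_sets L by simp
  have tsL: "topspace ?T = L" using LG topspace_eq_carrier by auto
  have gr: "group ?G" by (rule subgroup_imp_group[OF L(1)])
  have em: "emeasure ?M A = emeasure M A" if "A \<subseteq> L" for A
    using emeasure_restrict_space[of L M A] sets.Int[OF Ls sets.top] that by simp
  have sts: "A \<in> sets ?M \<longleftrightarrow> A \<in> sets M \<and> A \<subseteq> L" for A
    using sets_restrict_space_iff[of L M A] sets.Int[OF Ls sets.top] by auto
  interpret lcsc_group ?G ?T
  proof (intro lcsc_group.intro topological_group.intro topological_group_axioms.intro lcsc_group_axioms.intro gr)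
    show "topspace ?T = carrier ?G" using tsL by simp
    have "continuous_map (prod_topology ?T ?T) T (\<lambda>(x, y). x \<otimes> y)"
      unfolding subtopology_Times[symmetric] by (rule continuous_map_from_subtopology[OF continuous_mult])
    then show "continuous_map (prod_topology ?T ?T) ?T (\<lambda>(x, y). x \<otimes>\<^bsub>?G\<^esub> y)"
      by (auto intro!: continuous_map_into_subtopology)
    have "continuous_map ?T T (\<lambda>x. inv x)"
      by (rule continuous_map_from_subtopology[OF continuous_inv])
    then have "continuous_map ?T ?T (\<lambda>x. inv x)"
      by (auto intro!: continuous_map_into_subtopology)
    then show "continuous_map ?T ?T (\<lambda>x. inv\<^bsub>?G\<^esub> x)"
      by (rule continuous_map_eq) (use m_inv_consistent[OF L(1)] tsL in auto)
    show "Hausdorff_space ?T" by (rule Hausdorff_space_subtopology[OF Hausdorff])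
    show "locally_compact_space ?T"
      using locally_compact_space_open_subset[OF _ locally_compact L(2)] Hausdorff by blast
    show "second_countable ?T" by (rule second_countable_subtopology[OF second_countable_top])
  qed
  show ?thesis
  proof unfold_locales
    show "left_haar_measure ?G ?T ?M"
      unfolding left_haar_measure_def
    proof (intro conjI allI impI ballI)
      show "space ?M = topspace ?T" using tsL LG by (auto simp: space_restrict_space)
      have "sets ?M = (\<inter>) L ` sigma_sets (topspace T) {U. openin T U}"
        by (simp add: sets_restrict_space sets_M)
      also have "\<dots> = sigma_sets L ((\<inter>) L ` {U. openin T U})"
        using Ls LG topspace_eq_carrier by (intro sigma_sets_Int) (auto simp: sets_M)
      also have "(\<inter>) L ` {U. openin T U} = {U. openin ?T U}"
        by (auto simp: openin_subtopology_alt)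
      finally show "sets ?M = sigma_sets (topspace ?T) {U. openin ?T U}" unfolding tsL .
      show "emeasure ?M K < \<infinity>" if "compactin ?T K" for K
        using that emeasure_compact_finite em by (auto simp: compactin_subtopology)
      have "space ?M = L" using LG by (auto simp: space_restrict_space)
      moreover have "0 < emeasure M L" using emeasure_open_pos[OF L(2)] L.one_closed by blast
      ultimately show "emeasure ?M (space ?M) \<noteq> 0" using em[of L] by simp
      fix g A assume g: "g \<in> carrier ?G" and A: "A \<in> sets ?M"
      then have gL: "g \<in> L" and AL: "A \<subseteq> L" "A \<in> sets M" using sts by auto
      have "g <#\<^bsub>?G\<^esub> A = g <# A" by (simp add: l_coset_def)
      moreover have "g <# A \<subseteq> L" using gL AL by (auto simp: l_coset_def)
      ultimately show "emeasure ?M (g <#\<^bsub>?G\<^esub> A) = emeasure ?M A"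
        using em AL emeasure_l_coset[of g A] gL LG by auto
    qed
  qed
qed

text \<open>Right translation by \<open>g\<close> keeps subsets of \<open>L\<close> inside
  \<open>L\<close>, where the two measures agree. For a closed subgroup of measure zero the modular
  function can differ from the restriction.\<close>

lemma (in haar_group) log_modular_open_subgroup:
  assumes L: "subgroup L G" "openin T L" and g: "g \<in> L"
  shows "haar_group.log_modular (G\<lparr>carrier := L\<rparr>) (restrict_space M L) g = log_modular g"
proof (rule haar_group.log_modular_eqI[OF haar_group_open_subgroup[OF L]])
  interpret L: subgroup L G by fact
  have Ls: "L \<in> sets M" using open_sets L by simp
  have em: "emeasure (restrict_space M L) A = emeasure M A" if "A \<subseteq> L" for A
    using emeasure_restrict_space[of L M A] sets.Int[OF Ls sets.top] that by simp
  fix A assume "A \<in> sets (restrict_space M L)"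
  then have A: "A \<in> sets M" "A \<subseteq> L" using sets_restrict_space_iff[of L M A] sets.Int[OF Ls sets.top] by auto
  have "A #>\<^bsub>G\<lparr>carrier := L\<rparr>\<^esub> g = A #> g" by (simp add: r_coset_def)
  moreover have "A #> g \<subseteq> L" using g A by (auto simp: r_coset_def)
  ultimately show "emeasure (restrict_space M L) (A #>\<^bsub>G\<lparr>carrier := L\<rparr>\<^esub> g)
      = ennreal (exp (log_modular g)) * emeasure (restrict_space M L) A"
    using em A emeasure_r_coset[of g A] g by auto
qed

lemma (in haar_group) log_modular_vimage_subgroup:
  assumes "0 \<in> P" "\<And>x y. x \<in> P \<Longrightarrow> y \<in> P \<Longrightarrow> x - y \<in> P"
  shows "subgroup {x \<in> carrier G. log_modular x \<in> P} G"
proof (rule subgroupI)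
  have m: "- x \<in> P" if "x \<in> P" for x using assms(2)[OF assms(1) that] by simp
  fix a b assume "a \<in> {x \<in> carrier G. log_modular x \<in> P}"
  then show "inv a \<in> {x \<in> carrier G. log_modular x \<in> P}"
    using m by (auto simp: log_modular_inv)
  assume "b \<in> {x \<in> carrier G. log_modular x \<in> P}"
  then show "a \<otimes> b \<in> {x \<in> carrier G. log_modular x \<in> P}"
    using \<open>a \<in> {x \<in> carrier G. log_modular x \<in> P}\<close> assms(2)[of "log_modular a" "- log_modular b"] m
    by (auto simp: log_modular_mult)
qed (use assms(1) in \<open>auto intro!: exI[of _ \<one>]\<close>)

section \<open>Orbit equivalence by piecewise translation\<close>

lemma orbit_equivalent_homeomorphic_maps:
  assumes act: "nonsingular_action \<Lambda> \<phi> \<nu>" "nonsingular_action \<Gamma> \<psi> \<mu>"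
    and \<nu>: "space \<nu> = topspace S" "sets \<nu> = sigma_sets (topspace S) {U. openin S U}"
    and \<mu>: "space \<mu> = topspace T" "sets \<mu> = sigma_sets (topspace T) {U. openin T U}"
    and h: "homeomorphic_maps T S \<theta>' \<theta>" and d: "\<nu> = distr \<mu> \<nu> \<theta>'"
    and orb: "\<And>y. y \<in> topspace S \<Longrightarrow> \<theta> ` orbit \<Lambda> \<phi> y = orbit \<Gamma> \<psi> (\<theta> y)"
  shows "orbit_equivalent \<Lambda> \<phi> \<nu> \<Gamma> \<psi> \<mu>"
  unfolding orbit_equivalent_def
proof (intro conjI exI[of _ \<theta>] act)
  have c: "continuous_map T S \<theta>'" "continuous_map S T \<theta>"
    and inv: "\<And>x. x \<in> topspace T \<Longrightarrow> \<theta> (\<theta>' x) = x" "\<And>y. y \<in> topspace S \<Longrightarrow> \<theta>' (\<theta> y) = y"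
    using h by (auto simp: homeomorphic_maps_def)
  have sp: "\<And>x. x \<in> topspace T \<Longrightarrow> \<theta>' x \<in> topspace S" "\<And>y. y \<in> topspace S \<Longrightarrow> \<theta> y \<in> topspace T"
    using c by (auto simp: continuous_map_def)
  have m: "\<theta>' \<in> measurable \<mu> \<nu>" "\<theta> \<in> measurable \<nu> \<mu>"
    using measurable_continuous_map[OF \<mu> \<nu> c(1)] measurable_continuous_map[OF \<nu> \<mu> c(2)] by auto
  show "nonsingular_iso \<nu> \<mu> \<theta>"
    unfolding nonsingular_iso_def
  proof (intro conjI m(2))
    show bij: "bij_betw \<theta> (space \<nu>) (space \<mu>)"
      unfolding \<nu> \<mu> using inv sp by (intro bij_betw_byWitness[where f' = \<theta>']) auto
    have "inv_into (space \<nu>) \<theta> x = \<theta>' x" if "x \<in> space \<mu>" for x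
      using bij inv sp that \<nu> \<mu> by (intro inv_into_f_eq) (auto simp: bij_betw_def)
    then show "inv_into (space \<nu>) \<theta> \<in> measurable \<mu> \<nu>"
      using m(1) by (subst measurable_cong) auto
    \<comment> \<open>As \<open>\<nu>\<close> is the image of \<open>\<mu>\<close> under
      \<open>\<theta>'\<close>, the map \<open>\<theta>\<close> carries it back to
      \<open>\<mu>\<close> exactly, which is more than nonsingularity.\<close>
    have "distr \<nu> \<mu> \<theta> = distr (distr \<mu> \<nu> \<theta>') \<mu> \<theta>" using d by simp
    also have "\<dots> = distr \<mu> \<mu> (\<theta> \<circ> \<theta>')" by (rule distr_distr[OF m(2,1)])
    also have "\<dots> = distr \<mu> \<mu> (\<lambda>x. x)"
      by (rule distr_cong) (auto simp: inv \<mu>)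
    finally show "null_sets (distr \<nu> \<mu> \<theta>) = null_sets \<mu>" by simp
  qed
  show "AE x in \<nu>. \<theta> ` orbit \<Lambda> \<phi> x = orbit \<Gamma> \<psi> (\<theta> x)"
    using orb \<nu> by (intro AE_I2) simp
qed

lemma (in topological_group) continuous_map_piecewise_l_mult:
  assumes fib: "\<And>d. openin T {x \<in> carrier G. p x = d}"
    and c: "\<And>x. x \<in> carrier G \<Longrightarrow> c (p x) \<in> carrier G"
  shows "continuous_map T T (\<lambda>x. c (p x) \<otimes> x)"
  unfolding continuous_map_def
proof (intro conjI allI impI)
  show "(\<lambda>x. c (p x) \<otimes> x) \<in> topspace T \<rightarrow> topspace T"
    using c topspace_eq_carrier by auto
  fix W assume W: "openin T W"
  have "openin T {x \<in> topspace T. c d \<otimes> x \<in> W}" if "d \<in> p ` carrier G" for d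
    using continuous_map_l_mult[of "c d"] c W that by (auto simp: continuous_map_def)
  then have "openin T (\<Union>d\<in>p ` carrier G. {x \<in> carrier G. p x = d} \<inter> {x \<in> topspace T. c d \<otimes> x \<in> W})"
    using fib by (intro openin_Union) auto
  also have "(\<Union>d\<in>p ` carrier G. {x \<in> carrier G. p x = d} \<inter> {x \<in> topspace T. c d \<otimes> x \<in> W})
      = {x \<in> topspace T. c (p x) \<otimes> x \<in> W}"
    using topspace_eq_carrier by auto
  finally show "openin T {x \<in> topspace T. c (p x) \<otimes> x \<in> W}" .
qed

lemma null_sets_UN_iff:
  assumes "countable I" "\<And>i. i \<in> I \<Longrightarrow> X i \<in> sets M"
  shows "(\<Union>i\<in>I. X i) \<in> null_sets M \<longleftrightarrow> (\<forall>i\<in>I. X i \<in> null_sets M)"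
proof
  assume "(\<Union>i\<in>I. X i) \<in> null_sets M"
  then show "\<forall>i\<in>I. X i \<in> null_sets M"
    using null_sets_subset assms(2) UN_upper by metis
qed (rule null_sets_UN'[OF assms(1)], blast)

text \<open>The bijection \<open>\<sigma>\<close> of value sets need not be additive: a point of
  value \<open>d\<close> is multiplied on the left by an element of \<open>\<Gamma>\<close> of value
  \<open>\<sigma> d - d\<close>, which carries the fibre over \<open>d\<close> onto the fibre over
  \<open>\<sigma> d\<close>. Orbits match because two points of \<open>L\<close> in one
  \<open>\<Gamma>\<close>-orbit differ by an element of \<open>\<Gamma> \<inter> L\<close>.\<close>

lemma (in haar_group) ex_orbit_equivalent_log_modular_image:
  assumes mu: "haar_probability G T \<mu>"
    and \<Gamma>: "subgroup \<Gamma> G" "countable \<Gamma>" "dense_in T \<Gamma>"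
    and V: "openin T V" "\<one> \<in> V" "\<And>x. x \<in> V \<Longrightarrow> log_modular x = 0"
    and P: "0 \<in> P" "\<And>x y. x \<in> P \<Longrightarrow> y \<in> P \<Longrightarrow> x - y \<in> P" "P \<subseteq> log_modular ` carrier G" "infinite P"
  shows "\<exists>(H :: real monoid) S \<nu> \<Lambda> N. haar_group H S N \<and> haar_probability H S \<nu> \<and>
    subgroup \<Lambda> H \<and> countable \<Lambda> \<and> dense_in S \<Lambda> \<and>
    orbit_equivalent (H\<lparr>carrier := \<Lambda>\<rparr>) (left_translation H) \<nu>
      (G\<lparr>carrier := \<Gamma>\<rparr>) (left_translation G) \<mu> \<and>
    haar_group.log_modular H N ` carrier H = P"
proof -
  interpret \<Gamma>: subgroup \<Gamma> G by fact
  \<comment> \<open>\<open>haar_probability\<close> provides some Haar measure \<open>M'\<close>,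
    possibly other than \<open>M\<close>; equality of null sets moves everything to
    \<open>M\<close>.\<close>
  obtain M' where M': "left_haar_measure G T M'" "sets \<mu> = sets M'" "null_sets \<mu> = null_sets M'"
    and "prob_space \<mu>" using mu by (auto simp: haar_probability_def)
  interpret prob: prob_space \<mu> by fact
  interpret H': haar_group G T M' by unfold_locales fact
  have smu: "sets \<mu> = sets M" using M'(2) sets_M H'.sets_M by simp
  have nmu: "null_sets \<mu> = null_sets M" using null_sets_haar[OF M'(1)] M'(3) by simp
  have spmu: "space \<mu> = carrier G" using sets_eq_imp_space_eq[OF smu] by simp
  let ?F = "\<lambda>d. {x \<in> carrier G. log_modular x = d}"
  have F: "openin T (?F d)" for d
  proof (subst openin_subopen, intro ballI)
    fix x assume x: "x \<in> ?F d"
    have VG: "V \<subseteq> carrier G" using openin_subset[OF V(1)] topspace_eq_carrier by simp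
    have "x <# V \<subseteq> ?F d"
      using x V(3) VG by (auto simp: l_coset_def log_modular_mult subset_eq)
    moreover have "x \<in> x <# V" using x V(2) by (force simp: l_coset_def)
    ultimately show "\<exists>W. openin T W \<and> x \<in> W \<and> W \<subseteq> ?F d"
      using openin_l_coset[OF _ V(1), of x] x by blast
  qed
  define D where "D = log_modular ` carrier G"
  have D\<Gamma>: "\<exists>g\<in>\<Gamma>. log_modular g = d" if d: "d \<in> D" for d
  proof -
    have "?F d \<noteq> {}" using d by (auto simp: D_def)
    then have "\<Gamma> \<inter> ?F d \<noteq> {}"
      using \<Gamma>(3) F[of d] unfolding dense_in_def by (metis dense_intersects_open)
    then show ?thesis by auto
  qed
  have "D \<subseteq> log_modular ` \<Gamma>" using D\<Gamma> by force
  then have "countable D" by (rule countable_subset) (rule countable_image[OF \<Gamma>(2)])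
  have PD: "P \<subseteq> D" using P(3) by (simp add: D_def)
  then have "countable P" by (rule countable_subset) fact
  have "infinite D" using PD P(4) finite_subset by blast
  have Dd: "d - d' \<in> D" if "d \<in> D" "d' \<in> D" for d d'
  proof -
    obtain x y where "x \<in> carrier G" "y \<in> carrier G" "d = log_modular x" "d' = log_modular y"
      using \<open>d \<in> D\<close> \<open>d' \<in> D\<close> by (auto simp: D_def)
    then have "d - d' = log_modular (x \<otimes> inv y)" "x \<otimes> inv y \<in> carrier G"
      by (auto simp: log_modular_mult log_modular_inv)
    then show ?thesis unfolding D_def by blast
  qed
  obtain \<sigma> where \<sigma>: "bij_betw \<sigma> D P"
    using bij_betw_trans[OF to_nat_on_infinite[OF \<open>countable D\<close> \<open>infinite D\<close>]
        bij_betw_from_nat_into[OF \<open>countable P\<close> P(4)]] by blast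
  define \<tau> where "\<tau> = inv_into D \<sigma>"
  have \<sigma>P: "\<sigma> d \<in> P" "\<tau> (\<sigma> d) = d" if "d \<in> D" for d
    using \<sigma> that by (auto simp: bij_betw_def \<tau>_def)
  have \<tau>D: "\<tau> p \<in> D" "\<sigma> (\<tau> p) = p" if "p \<in> P" for p
    using \<sigma> that by (auto simp: bij_betw_def \<tau>_def inv_into_into f_inv_into_f)
  have "\<exists>g\<in>\<Gamma>. log_modular g = \<sigma> d - d" if "d \<in> D" for d
    using D\<Gamma>[OF Dd] \<sigma>P(1)[OF that] PD that by blast
  then obtain \<gamma> where \<gamma>: "\<And>d. d \<in> D \<Longrightarrow> \<gamma> d \<in> \<Gamma>" "\<And>d. d \<in> D \<Longrightarrow> log_modular (\<gamma> d) = \<sigma> d - d"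
    by metis
  have \<gamma>G: "\<gamma> d \<in> carrier G" if "d \<in> D" for d using \<gamma>(1)[OF that] by auto
  define L where "L = {x \<in> carrier G. log_modular x \<in> P}"
  have L: "subgroup L G" unfolding L_def by (rule log_modular_vimage_subgroup[OF P(1,2)])
  have "L = (\<Union>d\<in>P. ?F d)" by (auto simp: L_def)
  then have oL: "openin T L" using F by auto
  have LG: "L \<subseteq> carrier G" by (auto simp: L_def)
  define \<psi>' where "\<psi>' x = \<gamma> (log_modular x) \<otimes> x" for x
  \<comment> \<open>Outside \<open>P\<close> the value \<open>\<one>\<close> is a filler. It makes
    \<open>\<psi>\<close> a piecewise translation on all of \<open>G\<close>, whose continuity is
    then restricted to \<open>L\<close>.\<close>
  define c where "c d = (if d \<in> P then inv \<gamma> (\<tau> d) else \<one>)" for d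
  define \<psi> where "\<psi> x = c (log_modular x) \<otimes> x" for x
  have lmD: "log_modular x \<in> D" if "x \<in> carrier G" for x using that by (simp add: D_def)
  have \<psi>': "\<psi>' x \<in> L" "log_modular (\<psi>' x) = \<sigma> (log_modular x)" "\<psi> (\<psi>' x) = x" if x: "x \<in> carrier G" for x
  proof -
    note d = lmD[OF x]
    show l: "log_modular (\<psi>' x) = \<sigma> (log_modular x)"
      using x \<gamma>(2)[OF d] \<gamma>G[OF d] by (simp add: \<psi>'_def log_modular_mult)
    then show "\<psi>' x \<in> L" using \<sigma>P(1)[OF d] x \<gamma>G[OF d] by (simp add: L_def \<psi>'_def)
    show "\<psi> (\<psi>' x) = x"
      unfolding \<psi>_def l c_def using \<sigma>P[OF d] x \<gamma>G[OF d] by (simp add: \<psi>'_def m_assoc[symmetric])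
  qed
  have \<psi>: "\<psi> x \<in> carrier G" "\<psi>' (\<psi> x) = x" if x: "x \<in> L" for x
  proof -
    have xG: "x \<in> carrier G" and p: "log_modular x \<in> P" using x by (auto simp: L_def)
    note d = \<tau>D(1)[OF p]
    show "\<psi> x \<in> carrier G" using xG p \<gamma>G[OF d] by (simp add: \<psi>_def c_def)
    have "log_modular (\<psi> x) = \<tau> (log_modular x)"
      using xG p \<gamma>(2)[OF d] \<gamma>G[OF d] \<tau>D(2)[OF p] by (simp add: \<psi>_def c_def log_modular_mult log_modular_inv)
    then show "\<psi>' (\<psi> x) = x"
      using xG p \<gamma>G[OF d] by (simp add: \<psi>'_def) (simp add: \<psi>_def c_def m_assoc[symmetric])
  qed
  let ?G = "G\<lparr>carrier := L\<rparr>" and ?T = "subtopology T L" and ?M = "restrict_space M L"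
  interpret L: haar_group ?G ?T ?M by (rule haar_group_open_subgroup[OF L oL])
  have tsL: "topspace ?T = L" using LG topspace_eq_carrier by auto
  have cont: "continuous_map T ?T \<psi>'" "continuous_map ?T T \<psi>"
  proof -
    have "continuous_map T T \<psi>'"
      unfolding \<psi>'_def using \<gamma>G lmD by (intro continuous_map_piecewise_l_mult F) auto
    then show "continuous_map T ?T \<psi>'"
      using \<psi>'(1) topspace_eq_carrier by (intro continuous_map_into_subtopology) auto
    have "c (log_modular x) \<in> carrier G" if "x \<in> carrier G" for x
      using \<gamma>G \<tau>D(1) by (auto simp: c_def)
    then have "continuous_map T T \<psi>"
      unfolding \<psi>_def by (intro continuous_map_piecewise_l_mult F) auto
    then show "continuous_map ?T T \<psi>" by (rule continuous_map_from_subtopology)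
  qed
  \<comment> \<open>On each of countably many fibres \<open>\<psi>'\<close> is a left translation,
    so null sets are preserved both ways. This makes the image of \<open>\<mu>\<close> equivalent to
    Haar measure on \<open>L\<close>.\<close>
  have null: "{x \<in> carrier G. \<psi>' x \<in> C} \<in> null_sets M \<longleftrightarrow> C \<in> null_sets M"
    if C: "C \<in> sets M" "C \<subseteq> L" for C
  proof -
    let ?C = "\<lambda>d. C \<inter> ?F (\<sigma> d)" and ?X = "\<lambda>d. {x \<in> carrier G. \<gamma> d \<otimes> x \<in> C \<inter> ?F (\<sigma> d)}"
    have Cs: "?C d \<in> sets M" for d using C open_sets[OF F] by auto
    have Xs: "?X d \<in> sets M" if "d \<in> D" for d
      by (rule vimage_sets[OF measurable_l_mult[OF \<gamma>G[OF that]] Cs])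
    have eq: "?X d \<in> null_sets M \<longleftrightarrow> ?C d \<in> null_sets M" if "d \<in> D" for d
      using emeasure_l_vimage[OF \<gamma>G[OF that] Cs[of d]] Xs[OF that] Cs[of d] by (simp add: null_sets_def)
    have "x \<in> ?X d \<longleftrightarrow> log_modular x = d \<and> \<psi>' x \<in> C" if "x \<in> carrier G" "d \<in> D" for x d
      using that \<gamma>G[OF that(2)] \<gamma>(2)[OF that(2)] by (auto simp: log_modular_mult \<psi>'_def)
    then have X: "{x \<in> carrier G. \<psi>' x \<in> C} = (\<Union>d\<in>D. ?X d)"
      using lmD by blast
    have 1: "{x \<in> carrier G. \<psi>' x \<in> C} \<in> null_sets M \<longleftrightarrow> (\<forall>d\<in>D. ?X d \<in> null_sets M)"
      unfolding X by (rule null_sets_UN_iff[OF \<open>countable D\<close> Xs])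
    have C_eq: "C = (\<Union>d\<in>D. ?C d)"
    proof (intro equalityI subsetI)
      fix x assume x: "x \<in> C"
      then have "x \<in> carrier G" "log_modular x \<in> P" using C(2) by (auto simp: L_def)
      then show "x \<in> (\<Union>d\<in>D. ?C d)"
        using x \<tau>D[of "log_modular x"] by (intro UN_I[of "\<tau> (log_modular x)"]) auto
    qed auto
    have "(\<Union>d\<in>D. ?C d) \<in> null_sets M \<longleftrightarrow> (\<forall>d\<in>D. ?C d \<in> null_sets M)"
      by (rule null_sets_UN_iff[OF \<open>countable D\<close> Cs])
    then have 2: "C \<in> null_sets M \<longleftrightarrow> (\<forall>d\<in>D. ?C d \<in> null_sets M)"
      using C_eq by simp
    show ?thesis using 1 2 eq by simp
  qed
  obtain e :: "'a \<Rightarrow> real" where "inj_on e (carrier G)" using ex_inj_real by blast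
  then have e: "inj_on e L" using LG inj_on_subset by blast
  define H where "H = image_group e ?G"
  define S where "S = pullback_topology (e ` topspace ?T) (inv_into (topspace ?T) e) ?T"
  define e' where "e' = inv_into L e"
  have cH: "carrier H = e ` L" by (simp add: H_def image_group_carrier)
  have gH: "group H" unfolding H_def by (rule L.inj_imp_image_group_is_group) (simp add: e)
  have iso: "e \<in> iso ?G H" unfolding H_def by (rule inj_imp_image_group_iso) (simp add: e)
  have homeo: "homeomorphic_map ?T S e"
    unfolding S_def by (rule homeomorphic_map_pullback_topology) (simp only: tsL e)
  have tS: "topspace S = carrier H"
    using homeomorphic_imp_surjective_map[OF homeo] tsL cH by simp
  interpret H: lcsc_group H S
    by (rule lcsc_group_iso[OF L.lcsc_group_axioms gH iso homeo tS])
  \<comment> \<open>These are the Borel sets of the transported topology, not those of the real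
    line.\<close>
  define B where "B = sigma (topspace S) {U. openin S U}"
  have B: "space B = topspace S" "sets B = sigma_sets (topspace S) {U. openin S U}"
    unfolding B_def by (auto intro!: space_measure_of sets_measure_of dest: openin_subset)
  define N where "N = distr ?M B e"
  have N: "left_haar_measure H S N" and em: "e \<in> measurable ?M B"
    unfolding N_def
    using left_haar_measure_iso[OF L.haar_group_axioms H.topological_group_axioms iso homeo B] by auto
  interpret N: haar_group H S N by unfold_locales fact
  have hmaps: "homeomorphic_maps ?T S e e'"
  proof -
    obtain f where f: "homeomorphic_maps ?T S e f" using homeo homeomorphic_map_maps by blast
    then have "f y = e' y" if "y \<in> topspace S" for y
      using that e tS cH tsL unfolding homeomorphic_maps_def e'_def
      by (metis (no_types, lifting) imageE inv_into_f_f)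
    moreover have "continuous_map S ?T f" using f by (simp add: homeomorphic_maps_def)
    ultimately have "continuous_map S ?T e'" using continuous_map_eq by metis
    then show ?thesis
      using f e tS cH tsL by (auto simp: homeomorphic_maps_def e'_def f_inv_into_f)
  qed
  define \<theta>' where "\<theta>' = e \<circ> \<psi>'"
  define \<theta> where "\<theta> = \<psi> \<circ> e'"
  have "homeomorphic_maps T ?T \<psi>' \<psi>"
    using cont \<psi>'(3) \<psi>(2) tsL topspace_eq_carrier by (simp add: homeomorphic_maps_def)
  from homeomorphic_maps_compose[OF conjI[OF this hmaps]]
  have hom\<theta>: "homeomorphic_maps T S \<theta>' \<theta>" by (simp add: \<theta>'_def \<theta>_def)
  \<comment> \<open>Taking the image of \<open>\<mu>\<close> makes the orbit equivalence measure
    preserving; what remains to be shown is that this image is equivalent to Haar measure.\<close>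
  define \<nu> where "\<nu> = distr \<mu> B \<theta>'"
  have bmu: "space \<mu> = topspace T" "sets \<mu> = sigma_sets (topspace T) {U. openin T U}"
    using spmu topspace_eq_carrier smu sets_M by auto
  have \<theta>'m: "\<theta>' \<in> measurable \<mu> B"
    using measurable_continuous_map[OF bmu B] hom\<theta> by (simp add: homeomorphic_maps_def)
  have b\<nu>: "space \<nu> = topspace S" "sets \<nu> = sigma_sets (topspace S) {U. openin S U}"
    using B by (auto simp: \<nu>_def)
  have hp: "haar_probability H S \<nu>"
    unfolding haar_probability_def
  proof (intro conjI exI[of _ N] N)
    show "prob_space \<nu>" unfolding \<nu>_def by (rule prob.prob_space_distr[OF \<theta>'m])
    show "sets \<nu> = sets N" by (simp add: \<nu>_def N_def)
    have "A \<in> null_sets \<nu> \<longleftrightarrow> A \<in> null_sets N" if A: "A \<in> sets B" for A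
    proof -
      let ?C = "{x \<in> L. e x \<in> A}"
      have "e -` A \<inter> space ?M = ?C" using LG by (auto simp: space_restrict_space)
      then have "?C \<in> sets ?M" using measurable_sets[OF em A] by simp
      then have Cs: "?C \<in> sets M"
        using sets_restrict_space_iff[of L M ?C] sets.Int[OF open_sets[OF oL] sets.top] by simp
      have "A \<in> null_sets \<nu> \<longleftrightarrow> \<theta>' -` A \<inter> space \<mu> \<in> null_sets \<mu>"
        unfolding \<nu>_def using null_sets_distr_iff[OF \<theta>'m] A by simp
      also have "\<theta>' -` A \<inter> space \<mu> = {x \<in> carrier G. \<psi>' x \<in> ?C}"
        using \<psi>'(1) spmu by (auto simp: \<theta>'_def)
      also have "\<dots> \<in> null_sets \<mu> \<longleftrightarrow> ?C \<in> null_sets M"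
        unfolding nmu by (rule null[OF Cs]) auto
      also have "\<dots> \<longleftrightarrow> ?C \<in> null_sets ?M"
        using emeasure_restrict_space[of L M ?C] sets.Int[OF open_sets[OF oL] sets.top]
          Cs \<open>?C \<in> sets ?M\<close> by (auto simp: null_sets_def)
      also have "\<dots> \<longleftrightarrow> A \<in> null_sets N"
        unfolding N_def using null_sets_distr_iff[OF em] A \<open>e -` A \<inter> space ?M = ?C\<close> by simp
      finally show ?thesis .
    qed
    moreover have "sets \<nu> = sets B" "sets N = sets B" by (simp_all add: \<nu>_def N_def)
    ultimately show "null_sets \<nu> = null_sets N" by (auto simp: null_sets_def)
  qed
  define \<Lambda> where "\<Lambda> = e ` (\<Gamma> \<inter> L)"
  have hom: "group_hom ?G H e"
    using L.is_group gH iso by (auto simp: group_hom_def group_hom_axioms_def iso_def)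
  have sub: "subgroup \<Lambda> H"
    unfolding \<Lambda>_def
    by (rule group_hom.subgroup_img_is_subgroup[OF hom])
      (intro subgroup_incl subgroups_Inter_pair \<Gamma>(1) L Int_lower2)
  have cnt: "countable \<Lambda>" unfolding \<Lambda>_def using \<Gamma>(2) by auto
  have dense: "dense_in S \<Lambda>"
  proof -
    have "\<Lambda> \<inter> W \<noteq> {}" if W: "openin S W" "W \<noteq> {}" for W
    proof -
      let ?W = "{x \<in> topspace ?T. e x \<in> W}"
      have "openin ?T ?W"
        using homeomorphic_imp_continuous_map[OF homeo] W(1) by (auto simp: continuous_map_def)
      then have "openin T ?W" using openin_open_subtopology[OF oL] by blast
      moreover have "?W \<noteq> {}"
        using W openin_subset[OF W(1)] tS cH tsL by auto
      ultimately have "\<Gamma> \<inter> ?W \<noteq> {}"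
        using \<Gamma>(3) unfolding dense_in_def by (metis dense_intersects_open)
      then show ?thesis using tsL by (auto simp: \<Lambda>_def)
    qed
    then have "S closure_of \<Lambda> = topspace S" using dense_intersects_open by metis
    moreover have "\<Lambda> \<subseteq> topspace S" using tS cH by (auto simp: \<Lambda>_def)
    ultimately show ?thesis by (simp add: dense_in_def)
  qed
  have "orbit_equivalent (H\<lparr>carrier := \<Lambda>\<rparr>) (left_translation H) \<nu>
      (G\<lparr>carrier := \<Gamma>\<rparr>) (left_translation G) \<mu>"
  proof (rule orbit_equivalent_homeomorphic_maps[OF _ _ b\<nu> bmu hom\<theta>])
    show "nonsingular_action (H\<lparr>carrier := \<Lambda>\<rparr>) (left_translation H) \<nu>"
      by (rule H.nonsingular_action_left_translation[OF hp sub cnt])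
    show "nonsingular_action (G\<lparr>carrier := \<Gamma>\<rparr>) (left_translation G) \<mu>"
      by (rule nonsingular_action_left_translation[OF mu \<Gamma>(1,2)])
    show "\<nu> = distr \<mu> \<nu> \<theta>'"
      by (simp add: \<nu>_def cong: distr_cong)
    fix y assume "y \<in> topspace S"
    then obtain x where x: "x \<in> L" "y = e x" using tS cH by auto
    have xG: "x \<in> carrier G" using x LG by auto
    have e'e: "e' (e z) = z" if "z \<in> L" for z using e that by (simp add: e'_def)
    have \<psi>\<Gamma>: "\<exists>h\<in>\<Gamma>. \<psi> z = h \<otimes> z" if "z \<in> L" for z
      using that \<gamma>(1) \<tau>D(1) by (auto simp: \<psi>_def c_def L_def intro!: bexI[of _ "inv \<gamma> (\<tau> (log_modular z))"])
    have \<psi>'\<Gamma>: "\<exists>h\<in>\<Gamma>. \<psi>' z = h \<otimes> z" if "z \<in> carrier G" for z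
      using \<gamma>(1)[OF lmD[OF that]] by (auto simp: \<psi>'_def)
    obtain h where h: "h \<in> \<Gamma>" "\<psi> x = h \<otimes> x" using \<psi>\<Gamma>[OF x(1)] by blast
    have orb: "orbit (H\<lparr>carrier := \<Lambda>\<rparr>) (left_translation H) y = {e (g \<otimes> x) | g. g \<in> \<Gamma> \<inter> L}"
    proof -
      have "left_translation H (e g) y = e (g \<otimes> x)" if "g \<in> L" for g
        using that x e cH e'e[unfolded e'_def] by (simp add: left_translation_def H_def image_group_def)
      then have "(\<lambda>g. left_translation H (e g) y) ` (\<Gamma> \<inter> L) = (\<lambda>g. e (g \<otimes> x)) ` (\<Gamma> \<inter> L)"
        by (intro image_cong) auto
      moreover have "orbit (H\<lparr>carrier := \<Lambda>\<rparr>) (left_translation H) y = (\<lambda>g. left_translation H (e g) y) ` (\<Gamma> \<inter> L)"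
        unfolding orbit_def \<Lambda>_def by fastforce
      ultimately show ?thesis by blast
    qed
    have \<theta>e: "\<theta> (e (g \<otimes> x)) = \<psi> (g \<otimes> x)" if "g \<in> L" for g
      using e'e[OF subgroup.m_closed[OF L that x(1)]] by (simp add: \<theta>_def)
    have "\<theta> ` orbit (H\<lparr>carrier := \<Lambda>\<rparr>) (left_translation H) y = {\<theta> (e (g \<otimes> x)) | g. g \<in> \<Gamma> \<inter> L}"
      unfolding orb by blast
    also have "\<dots> = {\<psi> (g \<otimes> x) | g. g \<in> \<Gamma> \<inter> L}"
      by (intro Collect_cong ex_cong1) (auto simp: \<theta>e)
    also have "\<dots> = {g \<otimes> \<psi> x | g. g \<in> \<Gamma>}"
    proof (intro equalityI subsetI)
      fix z assume "z \<in> {\<psi> (g \<otimes> x) | g. g \<in> \<Gamma> \<inter> L}"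
      then obtain g where g: "g \<in> \<Gamma>" "g \<in> L" "z = \<psi> (g \<otimes> x)" by auto
      obtain k where k: "k \<in> \<Gamma>" "z = k \<otimes> (g \<otimes> x)"
        using \<psi>\<Gamma>[OF subgroup.m_closed[OF L g(2) x(1)]] g(3) by auto
      have "inv h \<otimes> (h \<otimes> x) = x" using h(1) xG by (simp add: m_assoc[symmetric])
      then have "z = (k \<otimes> g \<otimes> inv h) \<otimes> \<psi> x"
        using h k g(1) xG by (simp add: m_assoc)
      then show "z \<in> {g \<otimes> \<psi> x | g. g \<in> \<Gamma>}"
        using k g h by blast
    next
      fix z assume "z \<in> {g \<otimes> \<psi> x | g. g \<in> \<Gamma>}"
      then obtain g where g: "g \<in> \<Gamma>" "z = g \<otimes> \<psi> x" by auto
      have zG: "z \<in> carrier G" using g \<psi>(1)[OF x(1)] by auto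
      obtain k where k: "k \<in> \<Gamma>" "\<psi>' z = k \<otimes> z" using \<psi>'\<Gamma>[OF zG] by blast
      \<comment> \<open>This element of \<open>\<Gamma>\<close> sends \<open>x\<close> to
        \<open>\<psi>' z\<close>. Both points lie in \<open>L\<close>, hence so does
        \<open>j\<close>.\<close>
      define j where "j = k \<otimes> g \<otimes> h"
      have j: "j \<in> \<Gamma>" using k g h by (simp add: j_def)
      have jx: "\<psi>' z = j \<otimes> x"
        using k g h xG by (simp add: j_def m_assoc)
      have "j = (j \<otimes> x) \<otimes> inv x" using j xG by (simp add: m_assoc)
      then have "j \<in> L"
        using \<psi>'(1)[OF zG] x(1) subgroup.m_closed[OF L] subgroup.m_inv_closed[OF L] jx by metis
      moreover have "z = \<psi> (j \<otimes> x)" using \<psi>'(3)[OF zG] jx by simp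
      ultimately show "z \<in> {\<psi> (g \<otimes> x) | g. g \<in> \<Gamma> \<inter> L}" using j by blast
    qed
    also have "\<dots> = orbit (G\<lparr>carrier := \<Gamma>\<rparr>) (left_translation G) (\<theta> y)"
      using \<psi>(1)[OF x(1)] e'e x by (auto simp: orbit_def left_translation_def \<theta>_def)
    finally show "\<theta> ` orbit (H\<lparr>carrier := \<Lambda>\<rparr>) (left_translation H) y
        = orbit (G\<lparr>carrier := \<Gamma>\<rparr>) (left_translation G) (\<theta> y)" .
  qed
  moreover have "N.log_modular ` carrier H = P"
  proof -
    have "N.log_modular (e x) = log_modular x" if "x \<in> L" for x
      using log_modular_iso[OF L.haar_group_axioms N.haar_group_axioms iso homeo]
        log_modular_open_subgroup[OF L oL that] that by simp
    then have "N.log_modular ` carrier H = log_modular ` L" unfolding cH by (force simp: image_iff)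
    also have "\<dots> = P" using P(3) by (force simp: L_def)
    finally show ?thesis .
  qed
  ultimately show ?thesis
    using N.haar_group_axioms hp sub cnt dense by blast
qed

section \<open>Infinitely many pairwise non-isomorphic groups\<close>

theorem corollary2p2:
  fixes G :: "('a, 'm) monoid_scheme" and T :: "'a topology"
    and \<mu> :: "'a measure" and \<Gamma> :: "'a set"
  assumes "lcsc_group G T"
    and "\<not> unimodular G T"
    and "haar_probability G T \<mu>"
    and "subgroup \<Gamma> G" and "countable \<Gamma>" and "dense_in T \<Gamma>"
    and "strongly_ergodic_action (G\<lparr>carrier := \<Gamma>\<rparr>) (left_translation G) \<mu>"
  shows "\<exists>(H :: nat \<Rightarrow> real monoid) (S :: nat \<Rightarrow> real topology)
            (\<nu> :: nat \<Rightarrow> real measure) (\<Lambda> :: nat \<Rightarrow> real set).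
           (\<forall>i. lcsc_group (H i) (S i) \<and>
                haar_probability (H i) (S i) (\<nu> i) \<and>
                subgroup (\<Lambda> i) (H i) \<and> countable (\<Lambda> i) \<and> dense_in (S i) (\<Lambda> i) \<and>
                orbit_equivalent ((H i)\<lparr>carrier := \<Lambda> i\<rparr>) (left_translation (H i)) (\<nu> i)
                                 (G\<lparr>carrier := \<Gamma>\<rparr>) (left_translation G) \<mu>) \<and>
           (\<forall>i j. i \<noteq> j \<longrightarrow> \<not> topological_group_isomorphic (H i) (S i) (H j) (S j))"
proof -
  obtain M g A where M: "left_haar_measure G T M" and g: "g \<in> carrier G" and A: "A \<in> sets M"
    and neq: "emeasure M (A #>\<^bsub>G\<^esub> g) \<noteq> emeasure M A"
    using assms(2) by (auto simp: unimodular_def)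
  interpret lcsc_group G T by fact
  interpret haar_group G T M by unfold_locales fact
  obtain M' where M': "left_haar_measure G T M'" "sets \<mu> = sets M'" "null_sets \<mu> = null_sets M'"
    and "prob_space \<mu>" using assms(3) by (auto simp: haar_probability_def)
  interpret H': haar_group G T M' by unfold_locales fact
  have smu: "sets \<mu> = sets M" using M'(2) sets_M H'.sets_M by simp
  have nmu: "null_sets \<mu> = null_sets M" using null_sets_haar[OF M'(1)] M'(3) by simp
  have se: "strongly_ergodic \<mu> (orbit_relation (G\<lparr>carrier := \<Gamma>\<rparr>) (left_translation G) \<mu>)"
    using assms(7) by (simp add: strongly_ergodic_action_def)
  obtain V where V: "openin T V" "\<one>\<^bsub>G\<^esub> \<in> V" "\<And>x. x \<in> V \<Longrightarrow> log_modular x = 0"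
    using strongly_ergodic_imp_log_modular_locally_zero[OF \<open>prob_space \<mu>\<close> smu nmu assms(4,5) se] by blast
  define a where "a = log_modular g"
  have a: "a \<noteq> 0"
    using neq emeasure_r_coset[OF g A] by (auto simp: a_def)
  \<comment> \<open>\<open>Suc n\<close> avoids the zero subgroup, which is finite and so admits no
    bijection with the infinite set of all modular values.\<close>
  define P where "P n = range (\<lambda>k::int. of_int k * (real (Suc n) * a))" for n
  have "\<exists>(H :: real monoid) S \<nu> \<Lambda> N. haar_group H S N \<and> haar_probability H S \<nu> \<and>
    subgroup \<Lambda> H \<and> countable \<Lambda> \<and> dense_in S \<Lambda> \<and>
    orbit_equivalent (H\<lparr>carrier := \<Lambda>\<rparr>) (left_translation H) \<nu>
      (G\<lparr>carrier := \<Gamma>\<rparr>) (left_translation G) \<mu> \<and>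
    haar_group.log_modular H N ` carrier H = P n" for n
  proof (rule ex_orbit_equivalent_log_modular_image[OF assms(3-6) V])
    show "0 \<in> P n" unfolding P_def by (rule image_eqI[of _ _ 0]) auto
    show "x - y \<in> P n" if x: "x \<in> P n" and y: "y \<in> P n" for x y
    proof -
      obtain k l :: int where "x = k * (real (Suc n) * a)" "y = l * (real (Suc n) * a)"
        using x y unfolding P_def by blast
      then have "x - y = of_int (k - l) * (real (Suc n) * a)"
        by (simp only: of_int_diff left_diff_distrib)
      then show ?thesis unfolding P_def by blast
    qed
    show "P n \<subseteq> log_modular ` carrier G"
    proof
      fix x assume "x \<in> P n"
      then obtain k :: int where k: "x = k * (real (Suc n) * a)" unfolding P_def by blast
      show "x \<in> log_modular ` carrier G"
      proof (cases "k \<ge> 0")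
        case True
        then have "x = log_modular (g [^]\<^bsub>G\<^esub> (nat k * Suc n))"
          using k g by (simp only: log_modular_pow a_def of_nat_mult of_nat_nat)
        then show ?thesis using g by blast
      next
        case False
        then have "x = log_modular (inv\<^bsub>G\<^esub> (g [^]\<^bsub>G\<^esub> (nat (- k) * Suc n)))"
          using k g by (simp only: log_modular_inv nat_pow_closed log_modular_pow a_def of_nat_mult of_nat_nat)
        then show ?thesis using g by blast
      qed
    qed
    have "inj (\<lambda>k::int. of_int k * (real (Suc n) * a))"
      using a by (auto intro!: injI)
    then show "infinite (P n)"
      unfolding P_def using finite_imageD infinite_UNIV_int by blast
  qed
  then obtain H :: "nat \<Rightarrow> real monoid" and S \<nu> \<Lambda> N where
    H: "\<And>n. haar_group (H n) (S n) (N n)" "\<And>n. haar_probability (H n) (S n) (\<nu> n)"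
      "\<And>n. subgroup (\<Lambda> n) (H n)" "\<And>n. countable (\<Lambda> n)" "\<And>n. dense_in (S n) (\<Lambda> n)"
      "\<And>n. orbit_equivalent ((H n)\<lparr>carrier := \<Lambda> n\<rparr>) (left_translation (H n)) (\<nu> n)
        (G\<lparr>carrier := \<Gamma>\<rparr>) (left_translation G) \<mu>"
      "\<And>n. haar_group.log_modular (H n) (N n) ` carrier (H n) = P n"
    by metis
  have iso_imp_eq: "i = j" if top_iso: "topological_group_isomorphic (H i) (S i) (H j) (S j)" for i j
  proof -
    obtain f where f: "f \<in> iso (H i) (H j)" "homeomorphic_map (S i) (S j) f"
      using top_iso by (auto simp: topological_group_isomorphic_def)
    have "f ` carrier (H i) = carrier (H j)" using f(1) by (simp add: iso_def bij_betw_def)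
    \<comment> \<open>The Haar measures \<open>N i\<close> and \<open>N j\<close> were chosen
      independently, which \<open>log_modular_iso\<close> permits.\<close>
    then have "P j = (\<lambda>x. haar_group.log_modular (H j) (N j) (f x)) ` carrier (H i)"
      unfolding H(7)[symmetric] by (simp add: image_image[symmetric])
    also have "\<dots> = P i"
      unfolding H(7)[symmetric] using log_modular_iso[OF H(1) H(1) f] by (intro image_cong) auto
    finally have "P i = P j" by simp
    \<comment> \<open>The generator of one subgroup is an integer multiple of that of the other, and
      \<open>a \<noteq> 0\<close> cancels whatever its sign. Both directions together give mutual
      divisibility.\<close>
    have "\<exists>k::int. int (Suc m) = k * int (Suc n)" if "P m = P n" for m n
    proof -
      have "1 * (real (Suc m) * a) \<in> P m"
        unfolding P_def by (rule image_eqI[of _ _ 1]) auto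
      then have "1 * (real (Suc m) * a) \<in> P n" unfolding that .
      then obtain k :: int where "1 * (real (Suc m) * a) = of_int k * (real (Suc n) * a)"
        unfolding P_def by (rule rangeE)
      then have "real (Suc m) = k * real (Suc n)" using a by (simp del: of_nat_Suc)
      then have "real_of_int (int (Suc m)) = real_of_int (k * int (Suc n))" by simp
      then show ?thesis unfolding of_int_eq_iff by blast
    qed
    from this[OF \<open>P i = P j\<close>] this[OF \<open>P i = P j\<close>[symmetric]]
    have "int (Suc i) dvd int (Suc j)" "int (Suc j) dvd int (Suc i)"
      by (auto simp only: dvd_def mult.commute)
    then have "Suc i = Suc j" by (simp only: int_dvd_int_iff dvd_antisym)
    then show "i = j" by simp
  qed
  show ?thesis
  proof (intro exI[of _ H] exI[of _ S] exI[of _ \<nu>] exI[of _ \<Lambda>] conjI allI impI notI)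
    show "lcsc_group (H i) (S i)" for i
      by (rule haar_group.axioms(1)[OF H(1)])
    show False if "i \<noteq> j" "topological_group_isomorphic (H i) (S i) (H j) (S j)" for i j
      using that iso_imp_eq by blast
  qed (fact H(2-6))+
qed

end
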